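(* Let $\mathbb{K}$ be $\mathbb{R}$ or $\mathbb{C}$. Let $1\leq k\leq m$ and $n_{1},\ldots,n_{k}\geq 1$ be positive integers such that $n_{1}+\cdots+n_{k}=m$, and let $q_{1},\ldots,q_{k}\in(0,\infty)$. The following assertions are equivalent: (i) There is a constant $C_{k,q_{1}\ldots q_{k}}^{\mathbb{K}}\geq 1$ such that $$\left(\sum_{i_{1}=1}^{\infty}\left(\sum_{i_{2}=1}^{\infty}\left(\cdots\left(\sum_{i_{k-1}=1}^{\infty}\left(\sum_{i_{k}=1}^{\infty}\left\vert T\left(e_{i_{1}}^{n_{1}},\ldots,e_{i_{k}}^{n_{k}}\right)\right\vert^{q_{k}}\right)^{\frac{q_{k-1}}{q_{k}}}\right)^{\frac{q_{k-2}}{q_{k-1}}}\cdots\right)^{\frac{q_{2}}{q_{3}}}\right)^{\frac{q_{1}}{q_{2}}}\right)^{\frac{1}{q_{1}}}\leq C_{k,q_{1}\ldots q_{k}}^{\mathbb{K}}\left\Vert T\right\Vert$$ for all continuous $m$-linear forms $T:c_{0}\times\cdots\times c_{0}\rightarrow\mathbb{K}$. (ii) $\sum_{j\in A}\frac{1}{q_{j}}\leq\frac{\mathrm{card}(A)+1}{2}$ for all $A\subset\{1,\ldots,k\}$.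
   Context: $c_0$ is the Banach space of sequences in $\mathbb{K}$ converging to $0$, with the supremum norm, and $(e_j)_{j\ge 1}$ are its canonical unit vectors. The symbol $e_{j}^{n}$ means $(e_{j},\ldots,e_{j})$, i.e. $e_j$ repeated $n$ times, so $T(e_{i_1}^{n_1},\ldots,e_{i_k}^{n_k})$ is $T$ evaluated with $e_{i_1}$ in the first $n_1$ arguments, $e_{i_2}$ in the next $n_2$ arguments, and so on. $\|T\|$ is the usual norm of a continuous multilinear form: the supremum of $|T(x^{(1)},\ldots,x^{(m)})|$ over all $x^{(1)},\ldots,x^{(m)}$ in the closed unit ball of $c_0$. The constant in (i) does not depend on $T$. The iterated sum in (i) is, for $k=1$, simply $\left(\sum_{i_1}|T(e_{i_1}^{n_1})|^{q_1}\right)^{1/q_1}$. *)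

theory Defs
  imports "HOL-Analysis.Analysis"
begin

text \<open>
  The topology of \<^typ>\<open>nat\<close> is discrete, so \<^typ>\<open>nat \<Rightarrow>\<^sub>C 'a\<close> is the space of all bounded
  sequences with the supremum norm, and \<open>c0\<close> is its subspace of null sequences.
  Sequences are indexed from \<open>0\<close>.
\<close>

definition c0 :: "(nat \<Rightarrow>\<^sub>C 'a::real_normed_vector) set" where
  "c0 = {f. (\<lambda>j. apply_bcontfun f j) \<longlonglongrightarrow> 0}"

text \<open>
  The library only provides scaling of \<^typ>\<open>nat \<Rightarrow>\<^sub>C 'a\<close> by reals; the following is scaling by
  elements of the field \<^typ>\<open>'a\<close>.
\<close>

definition scale_seq :: "'a::real_normed_field \<Rightarrow> (nat \<Rightarrow>\<^sub>C 'a) \<Rightarrow> (nat \<Rightarrow>\<^sub>C 'a)" where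
  "scale_seq a f = Bcontfun (\<lambda>j. a * apply_bcontfun f j)"

lemma apply_scale_seq: "apply_bcontfun (scale_seq a f) = (\<lambda>j. a * apply_bcontfun f j)"
proof -
  have "bounded ((\<lambda>x. a * x) ` range (apply_bcontfun f))"
    by (intro bounded_linear_image bounded_linear_mult_right) simp
  then have "(\<lambda>j. a * apply_bcontfun f j) \<in> bcontfun"
    by (simp add: bcontfun_def image_image)
  then show ?thesis
    by (simp add: scale_seq_def Bcontfun_inverse)
qed

definition unit_seq :: "nat \<Rightarrow> (nat \<Rightarrow>\<^sub>C 'a::real_normed_field)" where
  "unit_seq i = Bcontfun (\<lambda>j. if j = i then 1 else 0)"

lemma apply_unit_seq:
  "apply_bcontfun (unit_seq i :: nat \<Rightarrow>\<^sub>C 'a::real_normed_field) = (\<lambda>j. if j = i then 1 else 0)"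
proof -
  have "range (\<lambda>j. if j = i then 1 else 0 :: 'a) \<subseteq> {0, 1}"
    by auto
  then have "bounded (range (\<lambda>j. if j = i then 1 else 0 :: 'a))"
    by (rule bounded_subset[rotated]) simp
  then have "(\<lambda>j. if j = i then 1 else 0 :: 'a) \<in> bcontfun"
    by (simp add: bcontfun_def)
  then show ?thesis
    by (simp add: unit_seq_def Bcontfun_inverse)
qed

lemma unit_seq_in_c0: "(unit_seq i :: nat \<Rightarrow>\<^sub>C 'a::real_normed_field) \<in> c0"
proof -
  have "\<forall>\<^sub>F j in sequentially. (if j = i then 1 else 0 :: 'a) = 0"
    using eventually_gt_at_top[of i] by eventually_elim auto
  then show ?thesis
    by (simp add: c0_def apply_unit_seq tendsto_eventually)
qed

text \<open>
  The \<open>m\<close>-fold product of \<open>c0\<close> consists of the functions on \<open>{..<m}\<close> with values in \<open>c0\<close>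
  (extended by \<^const>\<open>undefined\<close>); values of a form outside this set are irrelevant.
\<close>

definition c0_prod :: "nat \<Rightarrow> (nat \<Rightarrow> (nat \<Rightarrow>\<^sub>C 'a::real_normed_vector)) set" where
  "c0_prod m = PiE {..<m} (\<lambda>_. c0)"

definition multilinear_form ::
  "nat \<Rightarrow> ((nat \<Rightarrow> (nat \<Rightarrow>\<^sub>C 'a::real_normed_field)) \<Rightarrow> 'a) \<Rightarrow> bool" where
  "multilinear_form m T \<longleftrightarrow>
    (\<forall>x\<in>c0_prod m. \<forall>l<m.
      (\<forall>y\<in>c0. \<forall>z\<in>c0. T (x(l := y + z)) = T (x(l := y)) + T (x(l := z))) \<and>
      (\<forall>a. \<forall>y\<in>c0. T (x(l := scale_seq a y)) = a * T (x(l := y))))"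

definition continuous_form ::
  "nat \<Rightarrow> ((nat \<Rightarrow> (nat \<Rightarrow>\<^sub>C 'a::real_normed_field)) \<Rightarrow> 'a) \<Rightarrow> bool" where
  "continuous_form m T \<longleftrightarrow>
    continuous_map (product_topology (\<lambda>_. top_of_set c0) {..<m}) euclidean T"

definition form_norm ::
  "nat \<Rightarrow> ((nat \<Rightarrow> (nat \<Rightarrow>\<^sub>C 'a::real_normed_field)) \<Rightarrow> 'a) \<Rightarrow> real" where
  "form_norm m T = (SUP x\<in>PiE {..<m} (\<lambda>_. c0 \<inter> cball 0 1). norm (T x))"

text \<open>
  For \<open>ns = [n\<^sub>1, \<dots>, n\<^sub>k]\<close> and \<open>is = [i\<^sub>1, \<dots>, i\<^sub>k]\<close>: the tuple of length \<open>n\<^sub>1 + \<dots> + n\<^sub>k\<close> consisting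
  of \<open>n\<^sub>1\<close> copies of the unit vector with index \<open>i\<^sub>1\<close>, then \<open>n\<^sub>2\<close> copies of the one with
  index \<open>i\<^sub>2\<close>, and so on.
\<close>

definition unit_blocks :: "nat list \<Rightarrow> nat list \<Rightarrow> nat \<Rightarrow> (nat \<Rightarrow>\<^sub>C 'a::real_normed_field)" where
  "unit_blocks ns is =
    restrict (\<lambda>l. concat (map2 (\<lambda>n i. replicate n (unit_seq i)) ns is) ! l) {..<sum_list ns}"

text \<open>Only used with exponents \<open>p > 0\<close>.\<close>

definition ennpowr :: "ennreal \<Rightarrow> real \<Rightarrow> ennreal" where
  "ennpowr x p = (if x = \<infinity> then \<infinity> else ennreal (enn2real x powr p))"

text \<open>
  The iterated sum over \<open>i\<^sub>1, \<dots>, i\<^sub>k\<close> without the outermost exponent \<open>1 / q\<^sub>1\<close>. The sums are taken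
  in \<^typ>\<open>ennreal\<close>, so a divergent sum has the value \<open>\<infinity>\<close>. The case of the empty list is junk.
\<close>

fun iterated_sum :: "real list \<Rightarrow> (nat list \<Rightarrow> ennreal) \<Rightarrow> ennreal" where
  "iterated_sum [] F = F []"
| "iterated_sum [q] F = (\<Sum>i. ennpowr (F [i]) q)"
| "iterated_sum (q # r # qs) F =
    (\<Sum>i. ennpowr (iterated_sum (r # qs) (\<lambda>is. F (i # is))) (q / r))"

definition mixed_norm :: "real list \<Rightarrow> (nat list \<Rightarrow> ennreal) \<Rightarrow> ennreal" where
  "mixed_norm qs F = ennpowr (iterated_sum qs F) (1 / hd qs)"

end

theory Submission
  imports Defs
begin

text \<open>
  Everything is done over a field \<open>'a\<close> that is at once a real normed field and a real inner product
  space; \<open>\<real>\<close> and \<open>\<complex>\<close> are instances.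

  \<^bold>\<open>Sufficiency.\<close> Let \<open>a(i\<^sub>1, \<dots>, i\<^sub>k)\<close> be the value of \<open>T\<close> at the unit vectors with indices
  \<open>i\<^sub>1, \<dots>, i\<^sub>k\<close>, the \<open>j\<close>-th of them repeated \<open>n\<^sub>j\<close> times. Putting independent random signs on the
  arguments within a block, in such a way that the expectation of their product vanishes off the
  diagonal, shows that the \<open>k\<close>-linear form with coefficients \<open>a\<close> has norm at most the norm \<open>M\<close> of
  \<open>T\<close> (\<open>array_bound_blocks\<close>), so the blocks disappear. For the exponents \<open>(2, \<dots>, 2, 1, 2, \<dots>, 2)\<close> the mixed norm of \<open>a\<close> is at most
  \<open>2\<^bsup>k-1\<^esup> M\<close> (\<open>trunc_norm_endpoint\<close>): by Khinchine's inequality and Minkowski's inequality every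
  square sum may be replaced, at the cost of a factor 2, by an average over signs in that argument, and
  the remaining sum of absolute values is a value of the form at a suitable point. The condition for
  \<open>A = {j. 1/q\<^sub>j > 1/2}\<close> says that \<open>\<Sum>\<^sub>j max 0 (2/q\<^sub>j - 1) \<le> 1\<close>; so the vector of the \<open>1/q\<^sub>j\<close> lies
  below a convex combination of the vectors of reciprocals \<open>(1/2, \<dots>, 1, \<dots>, 1/2)\<close>. Hoelder's
  inequality (\<open>trunc_norm_interpolation\<close>) and the monotonicity of \<open>\<ell>\<^sub>q\<close> norms in \<open>q\<close> give the bound for
  all such exponents. Only sums over indices below \<open>N\<close> occur in this argument; their supremum over
  \<open>N\<close> is the mixed norm (\<open>mixed_norm_eq_SUP_trunc_norm\<close>).

  \<^bold>\<open>Necessity.\<close> Given \<open>A\<close> with \<open>d\<close> elements and \<open>N = 2\<^sup>r\<close>, take a form whose coefficients are zero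
  unless \<open>i\<^sub>j = 0\<close> for \<open>j \<notin> A\<close>, and are otherwise the product of the entries \<open>h(i, i')\<close> of the
  Walsh--Hadamard matrix of size \<open>N\<close> over consecutive indices with positions in \<open>A\<close>. Since \<open>h\<close> is
  \<open>\<surd>N\<close> times an isometry of \<open>\<ell>\<^sub>2\<close>, and each argument acts between two copies of \<open>h\<close> as a diagonal
  contraction, the form has norm at most \<open>N\<^bsup>(d+1)/2\<^esup>\<close> (\<open>form_norm_chain_le\<close>), while its mixed norm is
  \<open>N\<close> to the power \<open>\<Sum>\<^sub>j\<^sub>\<in>\<^sub>A 1/q\<^sub>j\<close>. Letting \<open>r\<close> grow gives the condition for \<open>A\<close>.
\<close>

section \<open>Truncated mixed norms\<close>

text \<open>
  The mixed norm with exponents \<open>qs\<close> of a nonnegative array indexed by lists, restricted to indices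
  below \<open>N\<close>. In contrast to \<^const>\<open>mixed_norm\<close>, the outermost root is taken at every level, so
  that the recursion passes from one mixed norm to a shorter one.
\<close>

fun trunc_norm :: "nat \<Rightarrow> real list \<Rightarrow> (nat list \<Rightarrow> real) \<Rightarrow> real" where
  "trunc_norm N [] f = f []"
| "trunc_norm N (q # qs) f = (\<Sum>i<N. trunc_norm N qs (\<lambda>is. f (i # is)) powr q) powr (1 / q)"

lemma trunc_norm_nonneg: "(\<And>is. 0 \<le> f is) \<Longrightarrow> 0 \<le> trunc_norm N qs f"
  by (cases qs) auto

lemma trunc_norm_1:
  assumes "\<And>is. 0 \<le> f is"
  shows "trunc_norm N (1 # qs) f = (\<Sum>i<N. trunc_norm N qs (\<lambda>is. f (i # is)))"
  using assms by (simp add: trunc_norm_nonneg sum_nonneg)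

lemma trunc_norm_2:
  assumes "\<And>is. 0 \<le> f is"
  shows "trunc_norm N (2 # qs) f = L2_set (\<lambda>i. trunc_norm N qs (\<lambda>is. f (i # is))) {..<N}"
  using assms
  by (simp add: L2_set_def trunc_norm_nonneg powr_half_sqrt sum_nonneg)

section \<open>Averages over signs\<close>

text \<open>
  A set \<open>S\<close> encodes the choice of signs that is \<open>-1\<close> on \<open>S\<close> and \<open>1\<close> elsewhere; \<open>sign_avg N\<close> is the
  expectation over \<open>N\<close> independent uniformly distributed signs.
\<close>

definition rsign :: "nat set \<Rightarrow> nat \<Rightarrow> real" where
  "rsign S i = (if i \<in> S then -1 else 1)"

definition sign_avg :: "nat \<Rightarrow> (nat set \<Rightarrow> 'b::real_vector) \<Rightarrow> 'b" where
  "sign_avg N \<phi> = (1 / 2 ^ N) *\<^sub>R (\<Sum>S\<in>Pow {..<N}. \<phi> S)"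

lemma abs_rsign [simp]: "\<bar>rsign S i\<bar> = 1"
  by (simp add: rsign_def)

lemma sign_avg_0 [simp]: "sign_avg 0 \<phi> = \<phi> {}"
  by (simp add: sign_avg_def)

lemma sign_avg_Suc:
  "sign_avg (Suc N) \<phi> = (1 / 2) *\<^sub>R (sign_avg N (\<lambda>S. \<phi> S + \<phi> (insert N S)))"
proof -
  have "(\<Sum>S\<in>Pow {..<Suc N}. \<phi> S) = (\<Sum>S\<in>Pow {..<N}. \<phi> S) + (\<Sum>S\<in>insert N ` Pow {..<N}. \<phi> S)"
    unfolding lessThan_Suc Pow_insert by (rule sum.union_disjoint) auto
  also have "(\<Sum>S\<in>insert N ` Pow {..<N}. \<phi> S) = (\<Sum>S\<in>Pow {..<N}. \<phi> (insert N S))"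
  proof -
    have "inj_on (insert N) (Pow {..<N})"
      by (auto simp: inj_on_def)
    then show ?thesis by (simp add: sum.reindex)
  qed
  finally show ?thesis
    by (simp add: sign_avg_def sum.distrib)
qed

lemma sign_avg_cong: "(\<And>S. S \<subseteq> {..<N} \<Longrightarrow> \<phi> S = \<psi> S) \<Longrightarrow> sign_avg N \<phi> = sign_avg N \<psi>"
  by (simp add: sign_avg_def)

lemma sign_avg_mono:
  fixes \<phi> \<psi> :: "nat set \<Rightarrow> real"
  shows "(\<And>S. \<phi> S \<le> \<psi> S) \<Longrightarrow> sign_avg N \<phi> \<le> sign_avg N \<psi>"
  by (auto simp: sign_avg_def intro!: divide_right_mono sum_mono)

lemma sign_avg_const [simp]: "sign_avg N (\<lambda>S. c) = c"
  by (simp add: sign_avg_def sum_constant_scaleR card_Pow)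

lemma sign_avg_add: "sign_avg N (\<lambda>S. \<phi> S + \<psi> S) = sign_avg N \<phi> + sign_avg N \<psi>"
  by (simp add: sign_avg_def sum.distrib scaleR_add_right)

lemma sign_avg_sum: "sign_avg N (\<lambda>S. \<Sum>i\<in>I. \<phi> i S) = (\<Sum>i\<in>I. sign_avg N (\<phi> i))"
  by (simp add: sign_avg_def scaleR_sum_right sum.swap[of _ "Pow {..<N}"])

lemma sign_avg_mult: "sign_avg N (\<lambda>S. c * \<phi> S) = c * sign_avg N \<phi>" for c :: real
  by (simp add: sign_avg_def sum_distrib_left)

lemma norm_sign_avg_le: "norm (sign_avg N \<phi>) \<le> sign_avg N (\<lambda>S. norm (\<phi> S))"
  by (simp add: sign_avg_def norm_sum divide_right_mono)

lemma rsign_new: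
  assumes "S \<subseteq> {..<N}"
  shows "rsign S N = 1" "rsign (insert N S) N = -1" "i < N \<Longrightarrow> rsign (insert N S) i = rsign S i"
  using assms by (auto simp: rsign_def)

lemma sign_avg_orthogonal:
  fixes B :: "nat \<Rightarrow> nat \<Rightarrow> 'b::real_vector"
  shows "sign_avg N (\<lambda>S. \<Sum>i<N. \<Sum>j<N. (rsign S i * rsign S j) *\<^sub>R B i j) = (\<Sum>i<N. B i i)"
proof (induction N)
  case (Suc N)
  define Q where "Q = (\<lambda>S. \<Sum>i<N. \<Sum>j<N. (rsign S i * rsign S j) *\<^sub>R B i j)"
  define L where "L S = (\<Sum>i<N. rsign S i *\<^sub>R (B i N + B N i))" for S
  let ?F = "\<lambda>S. \<Sum>i<Suc N. \<Sum>j<Suc N. (rsign S i * rsign S j) *\<^sub>R B i j"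
  have F: "?F S = (\<Sum>i<N. \<Sum>j<N. (rsign S i * rsign S j) *\<^sub>R B i j)
      + rsign S N *\<^sub>R L S + (rsign S N * rsign S N) *\<^sub>R B N N" for S
    by (simp add: L_def sum.distrib scaleR_sum_right scaleR_add_right algebra_simps)
  have "?F S + ?F (insert N S) = 2 *\<^sub>R (Q S + B N N)" if S: "S \<subseteq> {..<N}" for S
  proof -
    have "L (insert N S) = L S"
      unfolding L_def by (intro sum.cong refl) (simp add: rsign_new[OF S])
    moreover have "(\<Sum>i<N. \<Sum>j<N. (rsign (insert N S) i * rsign (insert N S) j) *\<^sub>R B i j) = Q S"
      unfolding Q_def by (intro sum.cong refl) (simp add: rsign_new[OF S])
    ultimately show ?thesis
      unfolding F by (simp add: Q_def rsign_new[OF S] scaleR_2 algebra_simps)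
  qed
  then have "sign_avg (Suc N) ?F = (1/2) *\<^sub>R sign_avg N (\<lambda>S. 2 *\<^sub>R (Q S + B N N))"
    unfolding sign_avg_Suc by (intro arg_cong[where f="\<lambda>x. (1/2) *\<^sub>R x"] sign_avg_cong)
  also have "\<dots> = sign_avg N Q + B N N"
    by (simp add: sign_avg_def scaleR_sum_right[symmetric] sum.distrib scaleR_add_right
        flip: sum_constant_scaleR) (simp add: card_Pow sum_constant_scaleR)
  also have "\<dots> = (\<Sum>i<Suc N. B i i)"
    using Suc.IH by (simp add: Q_def)
  finally show ?case .
qed simp

lemma sign_avg_square:
  fixes v :: "nat \<Rightarrow> 'b::real_inner"
  shows "sign_avg N (\<lambda>S. (norm (\<Sum>i<N. rsign S i *\<^sub>R v i))\<^sup>2) = (\<Sum>i<N. (norm (v i))\<^sup>2)"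
proof -
  have "(norm (\<Sum>i<N. rsign S i *\<^sub>R v i))\<^sup>2 = (\<Sum>i<N. \<Sum>j<N. (rsign S i * rsign S j) *\<^sub>R (v i \<bullet> v j))"
    for S
    by (simp add: power2_norm_eq_inner inner_sum_left inner_sum_right sum_distrib_left mult_ac
        inner_commute)
  then show ?thesis
    by (simp add: sign_avg_orthogonal power2_norm_eq_inner del: real_scaleR_def)
qed

lemma sign_avg_fourth_power:
  fixes v :: "nat \<Rightarrow> 'b::real_inner"
  shows "sign_avg N (\<lambda>S. (norm (\<Sum>i<N. rsign S i *\<^sub>R v i)) ^ 4) \<le> 3 * (\<Sum>i<N. (norm (v i))\<^sup>2)\<^sup>2"
proof (induction N)
  case (Suc N)
  define X where "X S = (\<Sum>i<N. rsign S i *\<^sub>R v i)" for S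
  define \<sigma> where "\<sigma> = (\<Sum>i<N. (norm (v i))\<^sup>2)"
  define w where "w = (norm (v N))\<^sup>2"
  let ?F = "\<lambda>S. (norm (\<Sum>i<Suc N. rsign S i *\<^sub>R v i)) ^ 4"
  have "?F S + ?F (insert N S) \<le> 2 * (norm (X S) ^ 4 + 6 * w * (norm (X S))\<^sup>2 + w\<^sup>2)"
    if S: "S \<subseteq> {..<N}" for S
  proof -
    have X: "(\<Sum>i<N. rsign (insert N S) i *\<^sub>R v i) = X S"
      unfolding X_def by (intro sum.cong refl) (simp add: rsign_new[OF S])
    have 4: "norm u ^ 4 = (u \<bullet> u)\<^sup>2" for u :: 'b
      by (simp add: power2_norm_eq_inner[symmetric])
    have C: "(X S \<bullet> v N)\<^sup>2 \<le> (X S \<bullet> X S) * (v N \<bullet> v N)"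
      by (rule Cauchy_Schwarz_ineq)
    have "?F S + ?F (insert N S) = (norm (X S + v N)) ^ 4 + (norm (X S - v N)) ^ 4"
      using X by (simp add: rsign_new[OF S] X_def)
    also have "\<dots> = 2 * ((X S \<bullet> X S)\<^sup>2 + 2 * (X S \<bullet> X S) * (v N \<bullet> v N) + 4 * (X S \<bullet> v N)\<^sup>2
        + (v N \<bullet> v N)\<^sup>2)"
      unfolding 4 by (simp add: inner_add_left inner_add_right inner_diff_left inner_diff_right
        inner_commute power2_eq_square algebra_simps)
    also have "\<dots> \<le> 2 * ((X S \<bullet> X S)\<^sup>2 + 6 * (v N \<bullet> v N) * (X S \<bullet> X S) + (v N \<bullet> v N)\<^sup>2)"
      using C by (simp add: algebra_simps)
    finally show ?thesis
      by (simp add: 4 w_def power2_norm_eq_inner)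
  qed
  then have "(\<Sum>S\<in>Pow {..<N}. ?F S + ?F (insert N S))
      \<le> (\<Sum>S\<in>Pow {..<N}. 2 * (norm (X S) ^ 4 + 6 * w * (norm (X S))\<^sup>2 + w\<^sup>2))"
    by (intro sum_mono) auto
  then have "sign_avg (Suc N) ?F
      \<le> (1/2) *\<^sub>R sign_avg N (\<lambda>S. 2 * (norm (X S) ^ 4 + 6 * w * (norm (X S))\<^sup>2 + w\<^sup>2))"
    unfolding sign_avg_Suc by (simp add: sign_avg_def divide_right_mono)
  also have "\<dots> = sign_avg N (\<lambda>S. norm (X S) ^ 4) + 6 * w * sign_avg N (\<lambda>S. (norm (X S))\<^sup>2) + w\<^sup>2"
    by (simp only: sign_avg_mult sign_avg_add sign_avg_const) simp
  also have "\<dots> \<le> 3 * \<sigma>\<^sup>2 + 6 * w * \<sigma> + w\<^sup>2"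
    using Suc.IH by (simp add: X_def \<sigma>_def sign_avg_square)
  also have "\<dots> \<le> 3 * (\<sigma> + w)\<^sup>2"
    by (simp add: power2_eq_square algebra_simps)
  finally show ?case
    by (simp add: \<sigma>_def w_def)
qed simp

text \<open>
  Khinchine's inequality in \<open>L\<^sub>1\<close> for vectors of an inner product space. With \<open>\<sigma>\<close> the left-hand side,
  it follows by averaging \<open>t \<ge> 3 t\<^sup>2 / (4 \<sigma>) - t\<^sup>4 / (16 \<sigma>\<^sup>3)\<close>, where \<open>t\<close> is the norm of the signed
  sum, whose second and fourth moments are \<open>\<sigma>\<^sup>2\<close> and at most \<open>3 \<sigma>\<^sup>4\<close>. The constant is not optimal.
\<close>

lemma khinchine:
  fixes v :: "nat \<Rightarrow> 'b::real_inner"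
  shows "L2_set (\<lambda>i. norm (v i)) {..<N} \<le> 2 * sign_avg N (\<lambda>S. norm (\<Sum>i<N. rsign S i *\<^sub>R v i))"
proof -
  define \<sigma> where "\<sigma> = L2_set (\<lambda>i. norm (v i)) {..<N}"
  define X where "X = (\<lambda>S. norm (\<Sum>i<N. rsign S i *\<^sub>R v i))"
  have sq: "\<sigma>\<^sup>2 = (\<Sum>i<N. (norm (v i))\<^sup>2)"
    by (simp add: \<sigma>_def L2_set_def sum_nonneg)
  have X0: "0 \<le> X S" for S by (simp add: X_def)
  show ?thesis
  proof (cases "\<sigma> = 0")
    case True
    have "0 \<le> sign_avg N X"
      using sign_avg_mono[of "\<lambda>_. 0" X N] X0 by simp
    then show ?thesis using True by (simp add: \<sigma>_def X_def)
  next
    case False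
    then have \<sigma>: "\<sigma> > 0"
      using L2_set_nonneg[of "\<lambda>i. norm (v i)" "{..<N}"] unfolding \<sigma>_def by linarith
    have pt: "(3 / (4 * \<sigma>)) * (X S)\<^sup>2 + (-1 / (16 * \<sigma> ^ 3)) * X S ^ 4 \<le> X S" for S
    proof -
      define t where "t = X S / \<sigma>"
      have t: "X S = t * \<sigma>" "0 \<le> t" using \<sigma> X0 by (auto simp: t_def)
      \<comment> \<open>the two sides of the inequality touch at \<open>t = 2\<close>\<close>
      have "0 \<le> t * ((t - 2)\<^sup>2 * (t + 4))" using t by simp
      also have "\<dots> = t ^ 4 - 12 * t\<^sup>2 + 16 * t"
        by (simp add: power2_eq_square power4_eq_xxxx algebra_simps)
      finally have "0 \<le> (t ^ 4 - 12 * t\<^sup>2 + 16 * t) * \<sigma>" using \<sigma> by simp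
      moreover have "(3 / (4 * \<sigma>)) * (X S)\<^sup>2 = 3/4 * t\<^sup>2 * \<sigma>"
        using \<sigma> by (simp add: t power_mult_distrib power2_eq_square)
      moreover have "(-1 / (16 * \<sigma> ^ 3)) * X S ^ 4 = - (t ^ 4 * \<sigma>) / 16"
        using \<sigma> by (simp add: t power_mult_distrib eval_nat_numeral)
      ultimately show ?thesis by (simp add: t algebra_simps)
    qed
    have m2: "sign_avg N (\<lambda>S. (X S)\<^sup>2) = \<sigma>\<^sup>2"
      by (simp add: X_def sign_avg_square sq)
    have m4: "sign_avg N (\<lambda>S. X S ^ 4) \<le> 3 * (\<sigma>\<^sup>2)\<^sup>2"
      using sign_avg_fourth_power[of N v] by (simp add: X_def sq)
    have "(3 / (4 * \<sigma>)) * \<sigma>\<^sup>2 + (-1 / (16 * \<sigma> ^ 3)) * (3 * (\<sigma>\<^sup>2)\<^sup>2)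
        \<le> (3 / (4 * \<sigma>)) * sign_avg N (\<lambda>S. (X S)\<^sup>2) + (-1 / (16 * \<sigma> ^ 3)) * sign_avg N (\<lambda>S. X S ^ 4)"
      unfolding m2 using \<sigma> by (intro add_left_mono mult_left_mono_neg m4) simp
    also have "\<dots> \<le> sign_avg N X"
      unfolding sign_avg_mult[symmetric] sign_avg_add[symmetric] by (intro sign_avg_mono pt)
    also have "(3 / (4 * \<sigma>)) * \<sigma>\<^sup>2 + (-1 / (16 * \<sigma> ^ 3)) * (3 * (\<sigma>\<^sup>2)\<^sup>2) = 9/16 * \<sigma>"
      using \<sigma> by (simp add: power2_eq_square power3_eq_cube field_simps)
    finally show ?thesis using \<sigma> by (simp add: \<sigma>_def X_def)
  qed
qed

section \<open>Cotype 2 of mixed norms\<close>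

lemma L2_set_sum_le:
  assumes "finite I"
  shows "L2_set (\<lambda>j. \<Sum>i\<in>I. g i j) J \<le> (\<Sum>i\<in>I. L2_set (g i) J)"
  using assms
proof (induction I rule: finite_induct)
  case (insert i I)
  then show ?case
    using L2_set_triangle_ineq[of "g i" "\<lambda>j. \<Sum>i\<in>I. g i j" J] by simp
qed (simp add: L2_set_def)

lemma L2_set_swap:
  "L2_set (\<lambda>j. L2_set (\<lambda>i. g i j) I) J = L2_set (\<lambda>i. L2_set (\<lambda>j. g i j) J) I"
  by (simp add: L2_set_def sum_nonneg) (rule sum.swap)

lemma L2_set_sign_avg_le:
  "L2_set (\<lambda>i. sign_avg N (\<lambda>S. g S i)) I \<le> sign_avg N (\<lambda>S. L2_set (g S) I)"
proof -
  have "L2_set (\<lambda>i. sign_avg N (\<lambda>S. g S i)) I = (1 / 2 ^ N) * L2_set (\<lambda>i. \<Sum>S\<in>Pow {..<N}. g S i) I"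
    by (subst L2_set_right_distrib) (simp_all add: sign_avg_def)
  also have "\<dots> \<le> (1 / 2 ^ N) * (\<Sum>S\<in>Pow {..<N}. L2_set (g S) I)"
    by (intro mult_left_mono L2_set_sum_le) auto
  finally show ?thesis
    by (simp add: sign_avg_def)
qed

text \<open>
  The space normed by \<^const>\<open>trunc_norm\<close> has cotype 2 when all exponents are 1 or 2: Minkowski's
  inequality pulls the square sum inside the mixed norm and the average back out of it.
\<close>

lemma trunc_norm_cotype_2:
  fixes a :: "nat \<Rightarrow> nat list \<Rightarrow> 'b::real_inner"
  assumes "set qs \<subseteq> {1, 2}"
  shows "L2_set (\<lambda>j. trunc_norm N qs (\<lambda>is. norm (a j is))) {..<K}
    \<le> 2 * sign_avg K (\<lambda>S. trunc_norm N qs (\<lambda>is. norm (\<Sum>j<K. rsign S j *\<^sub>R a j is)))"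
  using assms
proof (induction qs arbitrary: a)
  case Nil
  show ?case using khinchine[of "\<lambda>j. a j []" K] by simp
next
  case (Cons q qs)
  define R where "R = (\<lambda>i j. trunc_norm N qs (\<lambda>is. norm (a j (i # is))))"
  define E where "E = (\<lambda>S i. trunc_norm N qs (\<lambda>is. norm (\<Sum>j<K. rsign S j *\<^sub>R a j (i # is))))"
  have R0: "0 \<le> R i j" for i j by (simp add: R_def trunc_norm_nonneg)
  have IH: "L2_set (R i) {..<K} \<le> 2 * sign_avg K (\<lambda>S. E S i)" for i
    unfolding R_def E_def using Cons.prems by (intro Cons.IH) auto
  consider "q = 1" | "q = 2" using Cons.prems by auto
  then show ?case
  proof cases
    case 1
    have "L2_set (\<lambda>j. \<Sum>i<N. R i j) {..<K} \<le> (\<Sum>i<N. L2_set (R i) {..<K})"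
      by (rule L2_set_sum_le) simp
    also have "\<dots> \<le> (\<Sum>i<N. 2 * sign_avg K (\<lambda>S. E S i))"
      by (intro sum_mono IH)
    also have "\<dots> = 2 * sign_avg K (\<lambda>S. \<Sum>i<N. E S i)"
      by (simp add: sign_avg_sum sum_distrib_left)
    finally show ?thesis
      by (simp only: 1 trunc_norm_1[OF norm_ge_zero] R_def E_def)
  next
    case 2
    have "L2_set (\<lambda>j. L2_set (\<lambda>i. R i j) {..<N}) {..<K} = L2_set (\<lambda>i. L2_set (R i) {..<K}) {..<N}"
      by (rule L2_set_swap)
    also have "\<dots> \<le> L2_set (\<lambda>i. 2 * sign_avg K (\<lambda>S. E S i)) {..<N}"
      by (intro L2_set_mono IH) auto
    also have "\<dots> = 2 * L2_set (\<lambda>i. sign_avg K (\<lambda>S. E S i)) {..<N}"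
      by (subst L2_set_right_distrib) auto
    also have "\<dots> \<le> 2 * sign_avg K (\<lambda>S. L2_set (E S) {..<N})"
      by (intro mult_left_mono L2_set_sign_avg_le) auto
    finally show ?thesis
      by (simp only: 2 trunc_norm_2[OF norm_ge_zero] R_def E_def)
  qed
qed

section \<open>Extremal exponents\<close>

text \<open>
  The multilinear form with coefficient array \<open>a\<close>, evaluated at a list of vectors whose coordinates
  with index \<open>\<ge> N\<close> are disregarded.
\<close>

fun eval_array :: "nat \<Rightarrow> (nat \<Rightarrow> 'a::real_normed_field) list \<Rightarrow> (nat list \<Rightarrow> 'a) \<Rightarrow> 'a" where
  "eval_array N [] a = a []"
| "eval_array N (x # xs) a = (\<Sum>i<N. x i * eval_array N xs (\<lambda>is. a (i # is)))"

text \<open>The form in \<open>k\<close> arguments with coefficient array \<open>a\<close> has norm at most \<open>M\<close>.\<close>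

definition array_bound :: "nat \<Rightarrow> nat \<Rightarrow> (nat list \<Rightarrow> 'a::real_normed_field) \<Rightarrow> real \<Rightarrow> bool" where
  "array_bound N k a M \<longleftrightarrow>
    (\<forall>xs. length xs = k \<and> (\<forall>x\<in>set xs. \<forall>i. norm (x i) \<le> 1) \<longrightarrow> norm (eval_array N xs a) \<le> M)"

lemma eval_array_sum:
  "eval_array N xs (\<lambda>is. \<Sum>i\<in>I. c i * a i is) = (\<Sum>i\<in>I. c i * eval_array N xs (a i))"
proof (induction xs arbitrary: a)
  case (Cons x xs)
  then show ?case
    by (simp add: sum_distrib_left sum.swap[of _ I] algebra_simps)
qed simp

lemma eval_array_cong:
  assumes "\<And>is. length is = length xs \<Longrightarrow> a is = b is"
  shows "eval_array N xs a = eval_array N xs b"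
  using assms
proof (induction xs arbitrary: a b)
  case (Cons x xs)
  have "eval_array N xs (\<lambda>is. a (i # is)) = eval_array N xs (\<lambda>is. b (i # is))" for i
    using Cons.prems by (intro Cons.IH) auto
  then show ?case by simp
qed simp

lemma array_bound_contract:
  assumes "array_bound N (Suc k) a M" "\<And>i. norm (x i) \<le> 1"
  shows "array_bound N k (\<lambda>is. \<Sum>i<N. x i * a (i # is)) M"
  unfolding array_bound_def
proof safe
  fix xs :: "(nat \<Rightarrow> 'a) list"
  assume "k = length xs" "\<forall>x\<in>set xs. \<forall>i. norm (x i) \<le> 1"
  then have "norm (eval_array N (x # xs) a) \<le> M"
    using assms unfolding array_bound_def by (intro assms(1)[unfolded array_bound_def, rule_format]) auto
  then show "norm (eval_array N xs (\<lambda>is. \<Sum>i<N. x i * a (i # is))) \<le> M"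
    by (simp add: eval_array_sum)
qed

lemma array_bound_contract_second:
  assumes "array_bound N (Suc (Suc k)) a M" "\<And>i. norm (x i) \<le> 1"
  shows "array_bound N (Suc k) (\<lambda>js. \<Sum>i<N. x i * a (hd js # i # tl js)) M"
  unfolding array_bound_def
proof safe
  fix ys :: "(nat \<Rightarrow> 'a) list"
  assume ys: "length ys = Suc k" "\<forall>x\<in>set ys. \<forall>i. norm (x i) \<le> 1"
  then obtain y xs where [simp]: "ys = y # xs" by (cases ys) auto
  have "norm (eval_array N (y # x # xs) a) \<le> M"
    using assms ys by (intro assms(1)[unfolded array_bound_def, rule_format]) auto
  moreover have "eval_array N ys (\<lambda>js. \<Sum>i<N. x i * a (hd js # i # tl js)) = eval_array N (y # x # xs) a"
    by (simp add: eval_array_sum sum_distrib_left mult.left_commute) (rule sum.swap)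
  ultimately show "norm (eval_array N ys (\<lambda>js. \<Sum>i<N. x i * a (hd js # i # tl js))) \<le> M"
    by simp
qed

text \<open>
  For outermost exponent 1: the second index, which carries the outermost exponent 2, is replaced by
  an average over signs, and what remains is an array with one argument less. At the end a sum of
  absolute values is left.
\<close>

lemma trunc_norm_endpoint_outer:
  fixes a :: "nat list \<Rightarrow> 'a::{real_normed_field, real_inner}"
  assumes "array_bound N (Suc r) a M"
  shows "trunc_norm N (1 # replicate r 2) (\<lambda>is. norm (a is)) \<le> 2 ^ r * M"
  using assms
proof (induction r arbitrary: a)
  case 0
  define x where "x i = (if a [i] = 0 then 0 else of_real (norm (a [i])) / a [i])" for i
  have x: "norm (x i) \<le> 1" "x i * a [i] = of_real (norm (a [i]))" for i
    by (auto simp: x_def norm_divide)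
  have "norm (eval_array N [x] a) \<le> M"
    using 0 x(1) by (intro 0[unfolded array_bound_def, rule_format]) auto
  also have "eval_array N [x] a = of_real (\<Sum>i<N. norm (a [i]))"
    by (simp add: x(2))
  finally show ?case
    by (simp add: sum_nonneg del: of_real_sum)
next
  case (Suc r)
  let ?qs = "replicate r (2::real)"
  have qs: "set ?qs \<subseteq> {1, 2}" by auto
  define b where "b S js = (\<Sum>i<N. of_real (rsign S i) * a (hd js # i # tl js))" for S js
  have b: "array_bound N (Suc r) (b S) M" for S
    unfolding b_def by (intro array_bound_contract_second Suc.prems) simp
  have "trunc_norm N (1 # replicate (Suc r) 2) (\<lambda>is. norm (a is))
      = (\<Sum>i<N. L2_set (\<lambda>j. trunc_norm N ?qs (\<lambda>is. norm (a (i # j # is)))) {..<N})"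
    by (simp only: replicate_Suc trunc_norm_1[OF norm_ge_zero] trunc_norm_2[OF norm_ge_zero])
  also have "\<dots> \<le> (\<Sum>i<N. 2 * sign_avg N (\<lambda>S. trunc_norm N ?qs
      (\<lambda>is. norm (\<Sum>j<N. rsign S j *\<^sub>R a (i # j # is)))))"
    by (intro sum_mono trunc_norm_cotype_2 qs)
  also have "\<dots> = 2 * sign_avg N (\<lambda>S. trunc_norm N (1 # ?qs) (\<lambda>is. norm (b S is)))"
    by (simp only: trunc_norm_1[OF norm_ge_zero] sign_avg_sum sum_distrib_left[symmetric])
      (simp add: b_def scaleR_conv_of_real)
  also have "\<dots> \<le> 2 * sign_avg N (\<lambda>S. 2 ^ r * M)"
    by (intro mult_left_mono sign_avg_mono Suc.IH b) auto
  finally show ?case by simp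
qed

lemma trunc_norm_endpoint:
  fixes a :: "nat list \<Rightarrow> 'a::{real_normed_field, real_inner}"
  assumes "array_bound N (Suc (p + r)) a M"
  shows "trunc_norm N (replicate p 2 @ 1 # replicate r 2) (\<lambda>is. norm (a is)) \<le> 2 ^ (p + r) * M"
  using assms
proof (induction p arbitrary: a)
  case 0
  then show ?case using trunc_norm_endpoint_outer[of N r a M] by simp
next
  case (Suc p)
  let ?qs = "replicate p (2::real) @ 1 # replicate r 2"
  have qs: "set ?qs \<subseteq> {1, 2}" by auto
  have "trunc_norm N (replicate (Suc p) 2 @ 1 # replicate r 2) (\<lambda>is. norm (a is))
      = L2_set (\<lambda>j. trunc_norm N ?qs (\<lambda>is. norm (a (j # is)))) {..<N}"
    by (simp only: replicate_Suc append_Cons trunc_norm_2[OF norm_ge_zero])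
  also have "\<dots> \<le> 2 * sign_avg N (\<lambda>S. trunc_norm N ?qs (\<lambda>is. norm (\<Sum>j<N. rsign S j *\<^sub>R a (j # is))))"
    by (intro trunc_norm_cotype_2 qs)
  also have "\<dots> \<le> 2 * sign_avg N (\<lambda>S. 2 ^ (p + r) * M)"
    using Suc.prems unfolding scaleR_conv_of_real
    by (intro mult_left_mono sign_avg_mono Suc.IH array_bound_contract) auto
  finally show ?case by simp
qed

section \<open>Interpolation of mixed norms\<close>

lemma weighted_geo_mean_le_arith_mean:
  fixes x \<theta> :: "'j \<Rightarrow> real"
  assumes "finite J" "\<And>j. j \<in> J \<Longrightarrow> 0 \<le> \<theta> j" "sum \<theta> J = 1" "\<And>j. j \<in> J \<Longrightarrow> 0 \<le> x j"
  shows "(\<Prod>j\<in>J. x j powr \<theta> j) \<le> (\<Sum>j\<in>J. \<theta> j * x j)"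
proof (cases "\<exists>j\<in>J. x j = 0")
  case True
  then have "(\<Prod>j\<in>J. x j powr \<theta> j) = 0"
    using assms(1) by (auto intro!: prod_zero)
  also have "0 \<le> (\<Sum>j\<in>J. \<theta> j * x j)"
    using assms by (intro sum_nonneg mult_nonneg_nonneg)
  finally show ?thesis .
next
  case False
  then have pos: "0 < x j" if "j \<in> J" for j
    using assms(4)[OF that] that by (auto simp: order_le_less)
  have "(\<Prod>j\<in>J. x j powr \<theta> j) = exp (\<Sum>j\<in>J. \<theta> j *\<^sub>R ln (x j))"
    using assms(1) pos by (auto simp: exp_sum powr_def intro!: prod.cong dest: pos)
  also have "\<dots> \<le> (\<Sum>j\<in>J. \<theta> j * exp (ln (x j)))"
    using assms by (intro convex_on_sum[OF _ _ exp_convex]) auto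
  also have "\<dots> = (\<Sum>j\<in>J. \<theta> j * x j)"
    using pos by (intro sum.cong) auto
  finally show ?thesis .
qed

lemma holder_sum_prod:
  fixes a :: "'j \<Rightarrow> 'i \<Rightarrow> real"
  assumes "finite J" "finite I" "\<And>j. j \<in> J \<Longrightarrow> 0 \<le> \<theta> j" "sum \<theta> J = 1" "\<And>j i. 0 \<le> a j i"
  shows "(\<Sum>i\<in>I. \<Prod>j\<in>J. a j i powr \<theta> j) \<le> (\<Prod>j\<in>J. (\<Sum>i\<in>I. a j i) powr \<theta> j)"
proof (cases "\<exists>j\<in>J. (\<Sum>i\<in>I. a j i) = 0")
  case True
  then obtain j where j: "j \<in> J" "\<forall>i\<in>I. a j i = 0"
    using assms by (auto simp: sum_nonneg_eq_0_iff)
  then have "(\<Prod>j\<in>J. a j i powr \<theta> j) = 0" if "i \<in> I" for i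
    using assms(1) that by (auto intro!: prod_zero bexI[of _ j])
  then show ?thesis
    by (simp add: prod_nonneg)
next
  case False
  define A where "A j = (\<Sum>i\<in>I. a j i)" for j
  have A: "0 < A j" if "j \<in> J" for j
  proof -
    have "0 \<le> A j" by (simp add: A_def sum_nonneg assms(5))
    then show ?thesis using False that by (force simp: A_def less_le)
  qed
  then have P: "0 < (\<Prod>j\<in>J. A j powr \<theta> j)"
    by (intro prod_pos) (force simp: powr_def)
  have "(\<Sum>i\<in>I. \<Prod>j\<in>J. a j i powr \<theta> j) / (\<Prod>j\<in>J. A j powr \<theta> j)
      = (\<Sum>i\<in>I. \<Prod>j\<in>J. (a j i / A j) powr \<theta> j)"
    by (simp add: sum_divide_distrib powr_divide prod_dividef)
  also have "\<dots> \<le> (\<Sum>i\<in>I. \<Sum>j\<in>J. \<theta> j * (a j i / A j))"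
    using assms A by (intro sum_mono weighted_geo_mean_le_arith_mean) (auto simp: less_imp_le)
  also have "\<dots> = (\<Sum>j\<in>J. \<theta> j * ((\<Sum>i\<in>I. a j i) / A j))"
    by (subst sum.swap) (simp add: sum_distrib_left sum_divide_distrib)
  also have "\<dots> = (\<Sum>j\<in>J. \<theta> j)"
    using A unfolding A_def[symmetric] by (intro sum.cong) force+
  finally show ?thesis
    using P assms(4) by (simp add: A_def)
qed

text \<open>
  Hoelder's inequality for mixed norms: at each position, the reciprocal of the exponent in \<open>qs\<close> is
  the sum, with weights \<open>\<theta>\<close>, of the reciprocals of the exponents in the lists \<open>P j\<close>.
\<close>

lemma trunc_norm_interpolation:
  fixes g :: "'j \<Rightarrow> nat list \<Rightarrow> real"
  assumes "finite J" "\<And>j. j \<in> J \<Longrightarrow> 0 < \<theta> j"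
    and "\<And>j is. 0 \<le> g j is"
    and "\<And>j. j \<in> J \<Longrightarrow> length (P j) = length qs"
    and "\<And>j p. j \<in> J \<Longrightarrow> p \<in> set (P j) \<Longrightarrow> 0 < p"
    and "\<And>q. q \<in> set qs \<Longrightarrow> 0 < q"
    and "\<And>l. l < length qs \<Longrightarrow> 1 / qs ! l = (\<Sum>j\<in>J. \<theta> j / P j ! l)"
  shows "trunc_norm N qs (\<lambda>is. \<Prod>j\<in>J. g j is powr \<theta> j)
    \<le> (\<Prod>j\<in>J. trunc_norm N (P j) (g j) powr \<theta> j)"
  using assms
proof (induction qs arbitrary: g P)
  case Nil
  then show ?case by simp
next
  case (Cons q qs)
  define p where "p j = hd (P j)" for j
  define G where "G j i = trunc_norm N (tl (P j)) (\<lambda>is. g j (i # is))" for j i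
  have P: "P j = p j # tl (P j)" if "j \<in> J" for j
    using Cons.prems(4)[OF that] by (cases "P j") (auto simp: p_def)
  have q: "0 < q" using Cons.prems(6) by simp
  have p: "0 < p j" if "j \<in> J" for j
    using Cons.prems(5)[OF that] P[OF that] by (metis list.set_intros(1))
  have G0: "0 \<le> G j i" for j i
    unfolding G_def using Cons.prems(3) by (intro trunc_norm_nonneg) auto
  \<comment> \<open>the weights for Hoelder's inequality in the outermost sum\<close>
  have w: "(\<Sum>j\<in>J. \<theta> j * q / p j) = 1"
  proof -
    have "1 / q = (\<Sum>j\<in>J. \<theta> j / p j)"
      using Cons.prems(7)[of 0] P by (auto simp: p_def intro!: sum.cong) (metis P nth_Cons_0)
    then have "q * (1 / q) = (\<Sum>j\<in>J. q * (\<theta> j / p j))" by (simp only: sum_distrib_left)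
    then show ?thesis using q by (simp add: mult.commute)
  qed
  have IH: "trunc_norm N qs (\<lambda>is. \<Prod>j\<in>J. g j (i # is) powr \<theta> j) \<le> (\<Prod>j\<in>J. G j i powr \<theta> j)" for i
    unfolding G_def
  proof (rule Cons.IH)
    show "1 / qs ! l = (\<Sum>j\<in>J. \<theta> j / tl (P j) ! l)" if "l < length qs" for l
      using Cons.prems(7)[of "Suc l"] that P by (auto intro!: sum.cong) (metis P nth_Cons_Suc)
    show "0 < p" if "j \<in> J" "p \<in> set (tl (P j))" for j p
      using Cons.prems(5)[OF that(1)] that(2) P[OF that(1)] by (metis list.set_intros(2))
  qed (use Cons.prems in auto)
  have "(\<Sum>i<N. trunc_norm N qs (\<lambda>is. \<Prod>j\<in>J. g j (i # is) powr \<theta> j) powr q)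
      \<le> (\<Sum>i<N. (\<Prod>j\<in>J. G j i powr \<theta> j) powr q)"
    using q by (intro sum_mono powr_mono2 IH trunc_norm_nonneg prod_nonneg) auto
  also have "\<dots> = (\<Sum>i<N. \<Prod>j\<in>J. (G j i powr p j) powr (\<theta> j * q / p j))"
    using p by (intro sum.cong refl) (force simp: prod_powr_distrib powr_powr intro!: prod.cong)
  also have "\<dots> \<le> (\<Prod>j\<in>J. (\<Sum>i<N. G j i powr p j) powr (\<theta> j * q / p j))"
    using Cons.prems(1,2) p q w
    by (intro holder_sum_prod) (auto simp: less_imp_le intro!: divide_nonneg_pos mult_nonneg_nonneg)
  finally have "trunc_norm N (q # qs) (\<lambda>is. \<Prod>j\<in>J. g j is powr \<theta> j)
      \<le> (\<Prod>j\<in>J. (\<Sum>i<N. G j i powr p j) powr (\<theta> j * q / p j)) powr (1 / q)"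
    using q by (auto intro!: powr_mono2 sum_nonneg)
  also have "\<dots> = (\<Prod>j\<in>J. ((\<Sum>i<N. G j i powr p j) powr (1 / p j)) powr \<theta> j)"
    using q by (simp add: prod_powr_distrib powr_powr)
  also have "\<dots> = (\<Prod>j\<in>J. trunc_norm N (P j) (g j) powr \<theta> j)"
  proof (intro prod.cong refl)
    fix j assume "j \<in> J"
    show "((\<Sum>i<N. G j i powr p j) powr (1 / p j)) powr \<theta> j = trunc_norm N (P j) (g j) powr \<theta> j"
      by (subst P[OF \<open>j \<in> J\<close>]) (simp add: G_def)
  qed
  finally show ?case .
qed

lemma sum_powr_root_antimono:
  fixes x :: "'i \<Rightarrow> real"
  assumes "finite I" "\<And>i. i \<in> I \<Longrightarrow> 0 \<le> x i" "0 < p" "p \<le> q"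
  shows "(\<Sum>i\<in>I. x i powr q) powr (1 / q) \<le> (\<Sum>i\<in>I. x i powr p) powr (1 / p)"
proof -
  define S where "S = (\<Sum>i\<in>I. x i powr p) powr (1 / p)"
  have Sp: "S powr p = (\<Sum>i\<in>I. x i powr p)"
    using assms by (simp add: S_def powr_powr sum_nonneg)
  have le: "x i \<le> S" if "i \<in> I" for i
  proof -
    have "x i powr p \<le> (\<Sum>i\<in>I. x i powr p)"
      using assms that by (intro member_le_sum) auto
    then have "(x i powr p) powr (1 / p) \<le> S"
      unfolding S_def using assms by (intro powr_mono2) auto
    then show ?thesis using assms that by (simp add: powr_powr)
  qed
  have "(\<Sum>i\<in>I. x i powr q) = (\<Sum>i\<in>I. x i powr p * x i powr (q - p))"
    by (simp flip: powr_add)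
  also have "\<dots> \<le> (\<Sum>i\<in>I. x i powr p * S powr (q - p))"
    using assms le by (intro sum_mono mult_left_mono powr_mono2) auto
  also have "\<dots> = S powr q"
    by (simp flip: sum_distrib_right Sp powr_add)
  finally have "(\<Sum>i\<in>I. x i powr q) powr (1 / q) \<le> (S powr q) powr (1 / q)"
    using assms by (intro powr_mono2 sum_nonneg) auto
  also have "\<dots> = S"
    using assms by (simp add: powr_powr S_def)
  finally show ?thesis by (simp add: S_def)
qed

lemma trunc_norm_exponent_antimono:
  assumes "list_all2 (\<lambda>p q. 0 < p \<and> p \<le> q) ps qs" "\<And>is. 0 \<le> f is"
  shows "trunc_norm N qs f \<le> trunc_norm N ps f"
  using assms
proof (induction arbitrary: f rule: list_all2_induct)
  case (Cons p ps q qs)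
  have "trunc_norm N (q # qs) f \<le> (\<Sum>i<N. trunc_norm N qs (\<lambda>is. f (i # is)) powr p) powr (1 / p)"
    using Cons by (simp add: sum_powr_root_antimono trunc_norm_nonneg)
  also have "\<dots> \<le> trunc_norm N (p # ps) f"
    using Cons by (auto intro!: powr_mono2 sum_mono sum_nonneg trunc_norm_nonneg)
  finally show ?case .
qed simp

text \<open>
  The reciprocals of admissible exponents are dominated by convex combinations of the vectors
  \<open>(1/2, \<dots>, 1/2, 1, 1/2, \<dots>, 1/2)\<close>, for which the bound is known.
\<close>

theorem trunc_norm_le_array_bound:
  fixes a :: "nat list \<Rightarrow> 'a::{real_normed_field, real_inner}"
  assumes bound: "array_bound N (length qs) a M"
    and ne: "qs \<noteq> []" and pos: "\<And>q. q \<in> set qs \<Longrightarrow> 0 < q"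
    and sum_le: "(\<Sum>j<length qs. max 0 (2 / qs ! j - 1)) \<le> 1"
  shows "trunc_norm N qs (\<lambda>is. norm (a is)) \<le> 2 ^ (length qs - 1) * M"
proof -
  define k where "k = length qs"
  have k: "0 < k" using ne by (simp add: k_def)
  define t where "t j = max 0 (2 / qs ! j - 1)" for j
  have t0: "0 \<le> t j" for j by (simp add: t_def)
  \<comment> \<open>the first weight is increased to make the sum equal to 1\<close>
  define \<theta> where "\<theta> j = (if j = 0 then 1 - (\<Sum>l\<in>{..<k} - {0}. t l) else t j)" for j
  have split: "sum h {..<k} = h 0 + sum h ({..<k} - {0})" for h :: "nat \<Rightarrow> real"
    using k by (subst sum.remove[of _ 0]) auto
  have sum_\<theta>: "sum \<theta> {..<k} = 1"
    unfolding split by (simp add: \<theta>_def)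
  have t_le: "t j \<le> \<theta> j" for j
    using sum_le split[of t] by (auto simp: \<theta>_def t_def k_def)
  have \<theta>0: "0 \<le> \<theta> j" for j using t0 t_le order_trans by blast
  \<comment> \<open>zero weights are dropped because \<open>0 powr 0 = 0\<close>\<close>
  define J where "J = {j. j < k \<and> 0 < \<theta> j}"
  have fin: "finite J" by (simp add: J_def)
  have sum_J: "(\<Sum>j\<in>J. \<theta> j * h j) = (\<Sum>j<k. \<theta> j * h j)" for h
    using \<theta>0 by (intro sum.mono_neutral_left) (force simp: J_def order_le_less)+
  have sum_\<theta>J: "sum \<theta> J = 1" using sum_J[of "\<lambda>_. 1"] sum_\<theta> by simp
  then have J: "J \<noteq> {}" by auto
  define P where "P j = replicate j (2::real) @ 1 # replicate (k - 1 - j) 2" for j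
  define qs' where "qs' = map (\<lambda>l. 2 / (1 + \<theta> l)) [0..<k]"
  have lenP: "length (P j) = k" if "j < k" for j using that by (simp add: P_def)
  have nthP: "1 / P j ! l = (if j = l then 1 else 1 / 2)" if "j < k" "l < k" for j l
    using that by (auto simp: P_def nth_append nth_Cons split: nat.splits)
  have "list_all2 (\<lambda>p q. 0 < p \<and> p \<le> q) qs' qs"
  proof (rule list_all2_all_nthI)
    show "length qs' = length qs" by (simp add: qs'_def k_def)
    fix l assume "l < length qs'"
    then have l: "l < k" by (simp add: qs'_def)
    have q: "0 < qs ! l" using pos l by (simp add: k_def)
    have "2 / qs ! l \<le> 1 + \<theta> l" using t_le[of l] by (simp add: t_def)
    then have "2 / (1 + \<theta> l) \<le> qs ! l"
      using q \<theta>0[of l] by (simp add: field_simps)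
    then show "0 < qs' ! l \<and> qs' ! l \<le> qs ! l"
      using l \<theta>0[of l] by (simp add: qs'_def)
  qed
  then have "trunc_norm N qs (\<lambda>is. norm (a is)) \<le> trunc_norm N qs' (\<lambda>is. norm (a is))"
    by (rule trunc_norm_exponent_antimono) simp
  also have "\<dots> = trunc_norm N qs' (\<lambda>is. \<Prod>j\<in>J. norm (a is) powr \<theta> j)"
  proof -
    have "norm (a is) = (\<Prod>j\<in>J. norm (a is) powr \<theta> j)" for "is"
      using J fin sum_\<theta>J by (cases "a is = 0") (simp_all add: card_gt_0_iff flip: powr_sum)
    then show ?thesis by presburger
  qed
  also have "\<dots> \<le> (\<Prod>j\<in>J. trunc_norm N (P j) (\<lambda>is. norm (a is)) powr \<theta> j)"
  proof (rule trunc_norm_interpolation[OF fin])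
    show "1 / qs' ! l = (\<Sum>j\<in>J. \<theta> j / P j ! l)" if "l < length qs'" for l
    proof -
      have l: "l < k" using that by (simp add: qs'_def)
      have "(\<Sum>j\<in>J. \<theta> j / P j ! l) = (\<Sum>j\<in>J. \<theta> j * (1 / P j ! l))" by simp
      also have "\<dots> = (\<Sum>j<k. \<theta> j * (if j = l then 1 else 1 / 2))"
        unfolding sum_J using l nthP by (intro sum.cong) auto
      also have "\<dots> = (\<Sum>j<k. \<theta> j * (1 / 2) + (if j = l then \<theta> j / 2 else 0))"
        by (intro sum.cong) auto
      also have "\<dots> = 1 / 2 + \<theta> l / 2"
        using l by (simp add: sum.distrib sum_\<theta> flip: sum_divide_distrib)
      finally show ?thesis using l by (simp add: qs'_def add_divide_distrib)
    qed
    show "0 < q" if "q \<in> set qs'" for q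
      using that \<theta>0 by (auto simp: qs'_def intro!: add_pos_nonneg)
  qed (auto simp: J_def lenP qs'_def P_def)
  also have "\<dots> \<le> (\<Sum>j\<in>J. \<theta> j * trunc_norm N (P j) (\<lambda>is. norm (a is)))"
    using fin \<theta>0 sum_\<theta>J by (intro weighted_geo_mean_le_arith_mean) (auto simp: trunc_norm_nonneg)
  also have "\<dots> \<le> (\<Sum>j\<in>J. \<theta> j * (2 ^ (k - 1) * M))"
  proof (intro sum_mono mult_left_mono \<theta>0)
    fix j assume "j \<in> J"
    then have "j < k" by (simp add: J_def)
    then have "j + (k - 1 - j) = k - 1" "Suc (k - 1) = k" by auto
    then show "trunc_norm N (P j) (\<lambda>is. norm (a is)) \<le> 2 ^ (k - 1) * M"
      using trunc_norm_endpoint[of N j "k - 1 - j" a M] bound unfolding P_def k_def by simp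
  qed
  also have "\<dots> = 2 ^ (length qs - 1) * M"
    using sum_\<theta>J by (simp add: k_def flip: sum_distrib_right)
  finally show ?thesis .
qed

section \<open>Mixed norms as suprema of truncated mixed norms\<close>

lemma ennpowr_ennreal: "0 \<le> x \<Longrightarrow> ennpowr (ennreal x) p = ennreal (x powr p)"
  by (simp add: ennpowr_def)

lemma ennpowr_mono: "0 < p \<Longrightarrow> x \<le> y \<Longrightarrow> ennpowr x p \<le> ennpowr y p"
  by (cases x; cases y) (auto simp: ennpowr_def top_unique intro!: powr_mono2 ennreal_leI)

lemma ennpowr_ennpowr: "ennpowr (ennpowr x p) r = ennpowr x (p * r)"
  by (cases x) (auto simp: ennpowr_def powr_powr)

lemma ennpowr_1: "ennpowr x 1 = x"
  by (cases x) (auto simp: ennpowr_def)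

lemma ennpowr_SUP:
  fixes f :: "nat \<Rightarrow> ennreal"
  assumes "0 < p"
  shows "ennpowr (SUP n. f n) p = (SUP n. ennpowr (f n) p)"
proof (rule antisym)
  have "(SUP n. f n) \<le> ennpowr (SUP n. ennpowr (f n) p) (1 / p)"
  proof (rule SUP_least)
    fix n
    have "f n = ennpowr (ennpowr (f n) p) (1 / p)"
      using assms by (simp add: ennpowr_ennpowr ennpowr_1)
    also have "\<dots> \<le> ennpowr (SUP n. ennpowr (f n) p) (1 / p)"
      using assms by (intro ennpowr_mono SUP_upper) auto
    finally show "f n \<le> ennpowr (SUP n. ennpowr (f n) p) (1 / p)" .
  qed
  then have "ennpowr (SUP n. f n) p \<le> ennpowr (ennpowr (SUP n. ennpowr (f n) p) (1 / p)) p"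
    using assms by (intro ennpowr_mono)
  then show "ennpowr (SUP n. f n) p \<le> (SUP n. ennpowr (f n) p)"
    using assms by (simp add: ennpowr_ennpowr ennpowr_1)
next
  show "(SUP n. ennpowr (f n) p) \<le> ennpowr (SUP n. f n) p"
    using assms by (intro SUP_least ennpowr_mono SUP_upper) auto
qed

lemma trunc_norm_incseq:
  assumes "\<And>is. 0 \<le> f is" "\<And>q. q \<in> set qs \<Longrightarrow> 0 < q" "N \<le> N'"
  shows "trunc_norm N qs f \<le> trunc_norm N' qs f"
  using assms
proof (induction qs arbitrary: f)
  case (Cons q qs)
  have "(\<Sum>i<N. trunc_norm N qs (\<lambda>is. f (i # is)) powr q)
      \<le> (\<Sum>i<N. trunc_norm N' qs (\<lambda>is. f (i # is)) powr q)"
    using Cons.prems by (intro sum_mono powr_mono2 Cons.IH trunc_norm_nonneg) (auto simp: less_imp_le)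
  also have "\<dots> \<le> (\<Sum>i<N'. trunc_norm N' qs (\<lambda>is. f (i # is)) powr q)"
    using Cons.prems by (intro sum_mono2) auto
  finally show ?case
    using less_imp_le[OF Cons.prems(2)[of q]] by (auto intro!: powr_mono2 sum_nonneg)
qed simp

lemma ennpowr_suminf_SUP_trunc_norm:
  assumes "\<And>is. 0 \<le> f is" "\<And>p. p \<in> set (q # qs) \<Longrightarrow> 0 < p"
  shows "ennpowr (\<Sum>i. ennpowr (SUP N. ennreal (trunc_norm N qs (\<lambda>is. f (i # is)))) q) (1 / q)
    = (SUP N. ennreal (trunc_norm N (q # qs) f))"
proof -
  have q: "0 < q" using assms(2) by simp
  define r where "r N i = trunc_norm N qs (\<lambda>is. f (i # is)) powr q" for N i
  have r0: "0 \<le> r N i" for N i by (simp add: r_def)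
  have mono: "r N i \<le> r N' i" if "N \<le> N'" for N N' i
    unfolding r_def using assms(2)
    by (intro powr_mono2 trunc_norm_incseq trunc_norm_nonneg less_imp_le[OF q] assms(1) that) auto
  \<comment> \<open>the truncation of the sum is moved into the summands, which then increase with \<open>N\<close>\<close>
  define h where "h N i = (if i < N then ennreal (r N i) else 0)" for N i
  have inc: "incseq (\<lambda>N. h N i)" for i
    by (auto simp: h_def incseq_def mono ennreal_leI)
  have "ennpowr (SUP N. ennreal (trunc_norm N qs (\<lambda>is. f (i # is)))) q = (SUP N. h N i)" for i
  proof -
    have "ennpowr (SUP N. ennreal (trunc_norm N qs (\<lambda>is. f (i # is)))) q = (SUP N. ennreal (r N i))"
      using q assms(1) by (simp add: ennpowr_SUP ennpowr_ennreal trunc_norm_nonneg r_def)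
    also have "\<dots> = (SUP N. h N i)"
    proof (rule antisym)
      show "(SUP N. ennreal (r N i)) \<le> (SUP N. h N i)"
      proof (rule SUP_mono)
        fix N
        show "\<exists>N'\<in>UNIV. ennreal (r N i) \<le> h N' i"
          by (rule bexI[of _ "max N (Suc i)"]) (auto simp: h_def mono ennreal_leI)
      qed
      show "(SUP N. h N i) \<le> (SUP N. ennreal (r N i))"
        by (rule SUP_mono) (auto simp: h_def)
    qed
    finally show ?thesis .
  qed
  then have "(\<Sum>i. ennpowr (SUP N. ennreal (trunc_norm N qs (\<lambda>is. f (i # is)))) q)
      = (\<Sum>i. SUP N. h N i)" by simp
  also have "\<dots> = (SUP N. \<Sum>i. h N i)"
    by (rule ennreal_suminf_SUP_eq[OF inc])
  also have "\<dots> = (SUP N. ennreal (\<Sum>i<N. r N i))"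
  proof (rule SUP_cong[OF refl])
    fix N
    have "(\<Sum>i. h N i) = (\<Sum>i<N. h N i)"
      by (rule suminf_finite) (auto simp: h_def)
    also have "\<dots> = ennreal (\<Sum>i<N. r N i)"
      using r0 by (subst sum_ennreal[symmetric]) (auto simp: h_def)
    finally show "(\<Sum>i. h N i) = ennreal (\<Sum>i<N. r N i)" .
  qed
  finally show ?thesis
    using q r0 by (simp add: ennpowr_SUP ennpowr_ennreal sum_nonneg) (simp add: r_def)
qed

theorem mixed_norm_eq_SUP_trunc_norm:
  assumes "\<And>is. 0 \<le> f is" "\<And>q. q \<in> set qs \<Longrightarrow> 0 < q" "qs \<noteq> []"
  shows "mixed_norm qs (\<lambda>is. ennreal (f is)) = (SUP N. ennreal (trunc_norm N qs f))"
  using assms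
proof (induction qs arbitrary: f)
  case (Cons q qs)
  have "mixed_norm (q # qs) (\<lambda>is. ennreal (f is))
      = ennpowr (\<Sum>i. ennpowr (SUP N. ennreal (trunc_norm N qs (\<lambda>is. f (i # is)))) q) (1 / q)"
  proof (cases qs)
    case Nil
    then show ?thesis by (simp add: mixed_norm_def)
  next
    case (Cons r rs)
    have "mixed_norm (q # qs) (\<lambda>is. ennreal (f is))
        = ennpowr (\<Sum>i. ennpowr (mixed_norm qs (\<lambda>is. ennreal (f (i # is)))) q) (1 / q)"
      by (simp add: Cons mixed_norm_def ennpowr_ennpowr)
    then show ?thesis
      using Cons Cons.prems by (subst (asm) Cons.IH) auto
  qed
  also have "\<dots> = (SUP N. ennreal (trunc_norm N (q # qs) f))"
    by (rule ennpowr_suminf_SUP_trunc_norm) (use Cons.prems in auto)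
  finally show ?case .
qed simp

section \<open>Bounds for coefficients on a diagonal\<close>

lemma array_bound_Suc_iff:
  "array_bound N (Suc k) a M \<longleftrightarrow>
    (\<forall>x. (\<forall>i. norm (x i) \<le> 1) \<longrightarrow> array_bound N k (\<lambda>is. \<Sum>i<N. x i * a (i # is)) M)"
proof safe
  assume *: "\<forall>x. (\<forall>i. norm (x i) \<le> 1) \<longrightarrow> array_bound N k (\<lambda>is. \<Sum>i<N. x i * a (i # is)) M"
  show "array_bound N (Suc k) a M"
    unfolding array_bound_def
  proof safe
    fix ys :: "(nat \<Rightarrow> 'a) list"
    assume ys: "length ys = Suc k" "\<forall>x\<in>set ys. \<forall>i. norm (x i) \<le> 1"
    then obtain x xs where [simp]: "ys = x # xs" by (cases ys) auto
    have "array_bound N k (\<lambda>is. \<Sum>i<N. x i * a (i # is)) M"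
      using * ys by auto
    then have "norm (eval_array N xs (\<lambda>is. \<Sum>i<N. x i * a (i # is))) \<le> M"
      using ys by (simp add: array_bound_def)
    then show "norm (eval_array N ys a) \<le> M"
      by (simp add: eval_array_sum)
  qed
qed (rule array_bound_contract, auto)

text \<open>
  Restricting the coefficients to a diagonal in two arguments does not increase the norm: the
  diagonal form is the average of the given one over random signs put on both arguments.
\<close>

lemma array_bound_diagonal:
  assumes "array_bound N (Suc (Suc k)) a M"
  shows "array_bound N (Suc k) (\<lambda>js. a (hd js # js)) M"
  unfolding array_bound_def
proof safe
  fix ys :: "(nat \<Rightarrow> 'a) list"
  assume ys: "length ys = Suc k" "\<forall>x\<in>set ys. \<forall>i. norm (x i) \<le> 1"
  then obtain x xs where ys_eq: "ys = x # xs" by (cases ys) auto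
  define B where "B i j = x i * eval_array N xs (\<lambda>is. a (i # j # is))" for i j
  define v where "v S = (\<lambda>i. of_real (rsign S i) * x i) # (\<lambda>i. of_real (rsign S i)) # xs" for S
  have "eval_array N ys (\<lambda>js. a (hd js # js)) = (\<Sum>i<N. B i i)"
    by (simp add: ys_eq B_def)
  also have "\<dots> = sign_avg N (\<lambda>S. \<Sum>i<N. \<Sum>j<N. (rsign S i * rsign S j) *\<^sub>R B i j)"
    by (rule sign_avg_orthogonal[symmetric])
  also have "(\<lambda>S. \<Sum>i<N. \<Sum>j<N. (rsign S i * rsign S j) *\<^sub>R B i j) = (\<lambda>S. eval_array N (v S) a)"
    by (simp add: fun_eq_iff v_def B_def sum_distrib_left scaleR_conv_of_real algebra_simps)
  also have "norm (sign_avg N \<dots>) \<le> sign_avg N (\<lambda>S. norm (eval_array N (v S) a))"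
    by (rule norm_sign_avg_le)
  also have "\<dots> \<le> sign_avg N (\<lambda>S. M)"
    using ys by (intro sign_avg_mono assms[unfolded array_bound_def, rule_format])
      (auto simp: v_def ys_eq norm_mult)
  finally show "norm (eval_array N ys (\<lambda>js. a (hd js # js))) \<le> M" by simp
qed

text \<open>
  The first index of the new array stands for a whole block of \<open>n\<close> equal indices of the old one; the
  tails in the function below only split a list of length \<open>Suc k\<close> into its first entry and the rest.
\<close>

lemma array_bound_replicate:
  assumes "array_bound N (n + k) a M" "1 \<le> n"
  shows "array_bound N (Suc k) (\<lambda>js. a (replicate n (hd js) @ tl js)) M"
  using assms
proof (induction n arbitrary: a)
  case (Suc n)
  show ?case
  proof (cases "n = 0")
    case True
    then show ?thesis
      using Suc.prems(1) by (simp add: array_bound_Suc_iff)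
  next
    case False
    define b where "b js = a (hd js # replicate n (hd (tl js)) @ tl (tl js))" for js
    have "array_bound N (Suc k) (\<lambda>js. \<Sum>i<N. x i * a (i # replicate n (hd js) @ tl js)) M"
      if "\<forall>i. norm (x i) \<le> 1" for x
      using Suc.prems(1) that False
      by (intro Suc.IH[of "\<lambda>is. \<Sum>i<N. x i * a (i # is)"] array_bound_contract) auto
    then have "array_bound N (Suc (Suc k)) b M"
      by (subst array_bound_Suc_iff) (simp add: b_def)
    then have "array_bound N (Suc k) (\<lambda>js. b (hd js # js)) M"
      by (rule array_bound_diagonal)
    then show ?thesis by (simp add: b_def)
  qed
qed simp

lemma array_bound_blocks:
  assumes "array_bound N (sum_list ns) a M" "\<And>n. n \<in> set ns \<Longrightarrow> 1 \<le> n"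
  shows "array_bound N (length ns) (\<lambda>is. a (concat (map2 replicate ns is))) M"
  using assms
proof (induction ns arbitrary: a)
  case (Cons n ns)
  have "array_bound N (Suc (sum_list ns)) (\<lambda>js. a (replicate n (hd js) @ tl js)) M"
    using Cons.prems by (intro array_bound_replicate) auto
  then have "array_bound N (sum_list ns) (\<lambda>is. \<Sum>i<N. x i * a (replicate n i @ is)) M"
    if "\<forall>i. norm (x i) \<le> 1" for x
    using that by (simp add: array_bound_Suc_iff)
  then have "array_bound N (length ns)
      (\<lambda>is. \<Sum>i<N. x i * a (replicate n i @ concat (map2 replicate ns is))) M"
    if "\<forall>i. norm (x i) \<le> 1" for x
    using that Cons.prems
    by (intro Cons.IH[of "\<lambda>is. \<Sum>i<N. x i * a (replicate n i @ is)"]) auto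
  then show ?case
    by (simp add: array_bound_Suc_iff)
qed (simp add: array_bound_def)

section \<open>Continuous multilinear forms on null sequences\<close>

lemma c0_zero: "0 \<in> c0"
  by (simp add: c0_def)

lemma c0_add: "f \<in> c0 \<Longrightarrow> g \<in> c0 \<Longrightarrow> f + g \<in> c0"
  by (auto simp: c0_def plus_bcontfun.rep_eq intro: tendsto_add_zero)

lemma c0_scale_seq: "f \<in> c0 \<Longrightarrow> scale_seq a f \<in> c0"
  by (auto simp: c0_def apply_scale_seq intro: tendsto_mult_right_zero)

lemma norm_scale_seq_le: "norm (scale_seq a f) \<le> norm a * norm f"
  by (rule norm_bound) (simp add: apply_scale_seq norm_mult mult_left_mono norm_bounded)

text \<open>The sequence with entries \<open>x 0, \<dots>, x (N - 1)\<close> followed by zeros.\<close>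

definition finite_seq :: "nat \<Rightarrow> (nat \<Rightarrow> 'a) \<Rightarrow> (nat \<Rightarrow>\<^sub>C 'a::real_normed_field)" where
  "finite_seq N x = (\<Sum>i<N. scale_seq (x i) (unit_seq i))"

lemma apply_finite_seq: "apply_bcontfun (finite_seq N x) j = (if j < N then x j else 0)"
  by (induction N)
    (auto simp: finite_seq_def plus_bcontfun.rep_eq apply_scale_seq apply_unit_seq less_Suc_eq)

lemma finite_seq_in_c0: "finite_seq N x \<in> c0"
  by (induction N) (auto simp: finite_seq_def c0_zero c0_add c0_scale_seq unit_seq_in_c0)

lemma norm_finite_seq_le: "(\<And>i. norm (x i) \<le> 1) \<Longrightarrow> norm (finite_seq N x) \<le> 1"
  by (rule norm_bound) (simp add: apply_finite_seq)

text \<open>A list as an extensional function on its index set, as in \<^const>\<open>c0_prod\<close>.\<close>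

definition tuple_of_list :: "'b list \<Rightarrow> nat \<Rightarrow> 'b" where
  "tuple_of_list ls = restrict (\<lambda>l. ls ! l) {..<length ls}"

lemma tuple_of_list_in_c0_prod: "set ls \<subseteq> c0 \<Longrightarrow> tuple_of_list ls \<in> c0_prod (length ls)"
  by (auto simp: tuple_of_list_def c0_prod_def)

lemma tuple_of_list_update:
  "tuple_of_list (ys @ y # zs) = (tuple_of_list (ys @ z # zs))(length ys := y)"
  by (auto simp: tuple_of_list_def restrict_def fun_eq_iff nth_append nth_Cons split: nat.splits)

lemma multilinear_form_add:
  assumes "multilinear_form m T" "x \<in> c0_prod m" "l < m" "y \<in> c0" "z \<in> c0"
  shows "T (x(l := y + z)) = T (x(l := y)) + T (x(l := z))"
  using assms by (simp add: multilinear_form_def)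

lemma multilinear_form_scale:
  assumes "multilinear_form m T" "x \<in> c0_prod m" "l < m" "y \<in> c0"
  shows "T (x(l := scale_seq a y)) = a * T (x(l := y))"
  using assms by (simp add: multilinear_form_def)

lemma multilinear_form_finite_seq:
  fixes T :: "(nat \<Rightarrow> (nat \<Rightarrow>\<^sub>C 'a::real_normed_field)) \<Rightarrow> 'a"
  assumes "multilinear_form m T" "x \<in> c0_prod m" "l < m"
  shows "T (x(l := finite_seq N v)) = (\<Sum>i<N. v i * T (x(l := unit_seq i)))"
proof (induction N)
  case 0
  have "T (x(l := 0 + 0)) = T (x(l := 0)) + T (x(l := 0))"
    using assms c0_zero by (intro multilinear_form_add)
  then have "T (x(l := 0)) = 0" by simp
  moreover have "finite_seq 0 v = 0" by (simp add: finite_seq_def)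
  ultimately show ?case by (simp only: lessThan_0 sum.empty)
next
  case (Suc N)
  have "finite_seq (Suc N) v = finite_seq N v + scale_seq (v N) (unit_seq N)"
    by (simp add: finite_seq_def)
  then show ?case
    using Suc multilinear_form_add[OF assms finite_seq_in_c0[of N v] c0_scale_seq[OF unit_seq_in_c0], of "v N" N]
      multilinear_form_scale[OF assms unit_seq_in_c0] by (simp add: fun_upd_def)
qed

text \<open>
  By linearity in each argument, the form with the coefficients of \<open>T\<close> agrees with \<open>T\<close> on sequences
  supported below \<open>N\<close>. The arguments in \<open>ys\<close> are those already treated.
\<close>

lemma eval_array_form:
  assumes "multilinear_form m T" "set ys \<subseteq> c0" "length ys + length xs = m"
  shows "eval_array N xs (\<lambda>is. T (tuple_of_list (ys @ map unit_seq is)))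
    = T (tuple_of_list (ys @ map (finite_seq N) xs))"
  using assms(2,3)
proof (induction xs arbitrary: ys)
  case (Cons x xs)
  let ?Z = "\<lambda>z. tuple_of_list (ys @ z # map (finite_seq N) xs)"
  have "?Z 0 \<in> c0_prod (length (ys @ 0 # map (finite_seq N) xs))"
    using Cons.prems by (intro tuple_of_list_in_c0_prod) (auto simp: c0_zero finite_seq_in_c0)
  then have Z: "?Z 0 \<in> c0_prod m" using Cons.prems by simp
  have upd: "?Z z = (?Z 0)(length ys := z)" for z
    by (rule tuple_of_list_update)
  have "eval_array N (x # xs) (\<lambda>is. T (tuple_of_list (ys @ map unit_seq is)))
      = (\<Sum>i<N. x i * T (?Z (unit_seq i)))"
    using Cons.IH[of "ys @ [unit_seq i]" for i] Cons.prems by (simp add: unit_seq_in_c0)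
  also have "\<dots> = T (?Z (finite_seq N x))"
    using multilinear_form_finite_seq[OF assms(1) Z, of "length ys"] Cons.prems
    by (simp add: upd[symmetric])
  finally show ?case by simp
qed simp

lemma multilinear_form_scale_all:
  assumes "multilinear_form m T" "x \<in> c0_prod m" "p \<le> m"
  shows "T (\<lambda>l. if l < p then scale_seq a (x l) else x l) = a ^ p * T x"
  using assms(3)
proof (induction p)
  case (Suc p)
  let ?y = "\<lambda>l. if l < p then scale_seq a (x l) else x l"
  have y: "?y \<in> c0_prod m"
    using assms(2) Suc.prems by (auto simp: c0_prod_def PiE_iff c0_scale_seq extensional_def)
  have "(\<lambda>l. if l < Suc p then scale_seq a (x l) else x l) = ?y(p := scale_seq a (x p))"
    by (auto simp: fun_eq_iff less_Suc_eq)
  moreover have "x p \<in> c0"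
    using assms(2) Suc.prems by (auto simp: c0_prod_def PiE_iff)
  moreover have "?y(p := x p) = ?y" by auto
  ultimately show ?case
    using Suc multilinear_form_scale[OF assms(1) y, of p "x p" a] by simp
qed simp

text \<open>
  The real supremum in \<^const>\<open>form_norm\<close> is meaningful only for forms bounded on the unit ball.
  Continuity at \<open>0\<close> gives a bound on a small ball, and scaling all arguments transfers it.
\<close>

lemma bdd_above_form:
  assumes ml: "multilinear_form m T" and cont: "continuous_form m T"
  shows "bdd_above ((\<lambda>x. norm (T x)) ` (PiE {..<m} (\<lambda>_. c0 \<inter> cball 0 1)))"
proof -
  let ?X = "product_topology (\<lambda>_. top_of_set (c0 :: (nat \<Rightarrow>\<^sub>C 'a) set)) {..<m}"
  define z where "z = restrict (\<lambda>_. 0 :: nat \<Rightarrow>\<^sub>C 'a) {..<m}"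
  define W where "W = {x \<in> topspace ?X. T x \<in> ball (T z) 1}"
  have "openin ?X W"
    unfolding W_def using cont unfolding continuous_form_def
    by (intro openin_continuous_map_preimage[where Y=euclidean]) auto
  moreover have "z \<in> W"
    by (auto simp: W_def z_def c0_zero)
  ultimately obtain U where U: "\<And>l. l < m \<Longrightarrow> openin (top_of_set c0) (U l)"
    "z \<in> PiE {..<m} U" "PiE {..<m} U \<subseteq> W"
    unfolding openin_product_topology_alt by (auto dest!: bspec[of W _ z])
  have "\<exists>e>0. ball 0 e \<inter> c0 \<subseteq> U l" if "l < m" for l
  proof -
    have "0 \<in> U l" using U(2) that by (auto simp: z_def PiE_iff)
    then show ?thesis using U(1)[OF that] by (auto simp: openin_contains_ball)
  qed
  then obtain e where e: "\<And>l. l < m \<Longrightarrow> 0 < e l" "\<And>l. l < m \<Longrightarrow> ball 0 (e l) \<inter> c0 \<subseteq> U l"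
    by metis
  define d where "d = Min (insert 1 (e ` {..<m})) / 2"
  have d: "0 < d" using e(1) by (auto simp: d_def)
  have d_eq: "Min (insert 1 (e ` {..<m})) = 2 * d" by (simp add: d_def)
  have d_less: "d < e l" if "l < m" for l
  proof -
    have "Min (insert 1 (e ` {..<m})) \<le> e l" using that by (intro Min_le) auto
    then show ?thesis using d unfolding d_eq by linarith
  qed
  show ?thesis
  proof (rule bdd_aboveI2)
    fix x :: "nat \<Rightarrow> (nat \<Rightarrow>\<^sub>C 'a)"
    assume x: "x \<in> PiE {..<m} (\<lambda>_. c0 \<inter> cball 0 1)"
    then have xc: "x \<in> c0_prod m" by (auto simp: c0_prod_def PiE_iff)
    let ?y = "\<lambda>l. if l < m then scale_seq (of_real d) (x l) else x l"
    have "?y \<in> PiE {..<m} U"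
    proof (rule PiE_I)
      fix l assume "l \<in> {..<m}"
      then have l: "l < m" by simp
      then have xl: "x l \<in> c0" "norm (x l) \<le> 1" using x by (auto simp: PiE_iff)
      have "norm (scale_seq (of_real d) (x l)) \<le> d * norm (x l)"
        using norm_scale_seq_le[of "of_real d" "x l"] d by simp
      also have "\<dots> \<le> d * 1" using d xl by (intro mult_left_mono) auto
      finally have "norm (scale_seq (of_real d) (x l)) < e l" using d_less[OF l] by simp
      then show "?y l \<in> U l" using e(2)[OF l] l xl by (auto simp: c0_scale_seq)
    qed (use x in \<open>auto simp: PiE_iff extensional_def\<close>)
    then have "T ?y \<in> ball (T z) 1" using U(3) by (auto simp: W_def)
    then have "norm (T ?y) \<le> norm (T z) + 1"
      using norm_triangle_ineq2[of "T ?y" "T z"] by (simp add: dist_norm norm_minus_commute)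
    moreover have "norm (T ?y) = d ^ m * norm (T x)"
      using multilinear_form_scale_all[OF ml xc, of m "of_real d"] d by (simp add: norm_mult norm_power)
    ultimately show "norm (T x) \<le> (norm (T z) + 1) / d ^ m"
      using d by (simp add: field_simps)
  qed
qed

lemma norm_le_form_norm:
  assumes "multilinear_form m T" "continuous_form m T" "x \<in> PiE {..<m} (\<lambda>_. c0 \<inter> cball 0 1)"
  shows "norm (T x) \<le> form_norm m T"
  unfolding form_norm_def using assms by (intro cSUP_upper bdd_above_form)

lemma array_bound_form_norm:
  assumes "multilinear_form m T" "continuous_form m T"
  shows "array_bound N m (\<lambda>js. T (tuple_of_list (map unit_seq js))) (form_norm m T)"
  unfolding array_bound_def
proof (intro allI impI, elim conjE)
  fix xs :: "(nat \<Rightarrow> 'a) list"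
  assume xs: "length xs = m" "\<forall>x\<in>set xs. \<forall>i. norm (x i) \<le> 1"
  have "tuple_of_list (map (finite_seq N) xs) \<in> PiE {..<m} (\<lambda>_. c0 \<inter> cball 0 1)"
    using xs by (auto simp: tuple_of_list_def finite_seq_in_c0 intro!: norm_finite_seq_le)
  moreover have "eval_array N xs (\<lambda>js. T (tuple_of_list (map unit_seq js)))
      = T (tuple_of_list (map (finite_seq N) xs))"
    using eval_array_form[OF assms(1), of "[]" xs N] xs by simp
  ultimately show "norm (eval_array N xs (\<lambda>js. T (tuple_of_list (map unit_seq js)))) \<le> form_norm m T"
    using norm_le_form_norm[OF assms] by simp
qed

lemma unit_blocks_eq:
  assumes "length is = length ns"
  shows "unit_blocks ns is = tuple_of_list (map unit_seq (concat (map2 replicate ns is)))"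
proof -
  have "map (unit_seq :: nat \<Rightarrow> _) (concat (map2 replicate ns is))
      = concat (map2 (\<lambda>n i. replicate n (unit_seq i)) ns is)"
    by (induction ns "is" rule: list_induct2') auto
  moreover have "length (concat (map2 replicate ns is)) = sum_list ns"
    using assms by (induction "is" ns rule: list_induct2) auto
  ultimately show ?thesis
    by (metis length_map tuple_of_list_def unit_blocks_def)
qed

lemma array_bound_cong:
  assumes "\<And>is. length is = k \<Longrightarrow> a is = b is"
  shows "array_bound N k a M \<longleftrightarrow> array_bound N k b M"
  using eval_array_cong[of _ a b N] assms by (auto simp: array_bound_def)

theorem mixed_norm_le_form_norm:
  fixes T :: "(nat \<Rightarrow> (nat \<Rightarrow>\<^sub>C 'a::{real_normed_field, real_inner})) \<Rightarrow> 'a"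
  assumes T: "multilinear_form (sum_list ns) T" "continuous_form (sum_list ns) T"
    and ns: "\<And>n. n \<in> set ns \<Longrightarrow> 1 \<le> n"
    and qs: "length qs = length ns" "qs \<noteq> []" "\<And>q. q \<in> set qs \<Longrightarrow> 0 < q"
    and sum_le: "(\<Sum>j<length qs. max 0 (2 / qs ! j - 1)) \<le> 1"
  shows "mixed_norm qs (\<lambda>is. ennreal (norm (T (unit_blocks ns is))))
    \<le> ennreal (2 ^ (length qs - 1) * form_norm (sum_list ns) T)"
proof -
  have "array_bound N (length qs) (\<lambda>is. T (unit_blocks ns is)) (form_norm (sum_list ns) T)" for N
    using array_bound_blocks[OF array_bound_form_norm[OF T] ns]
    by (subst array_bound_cong[OF arg_cong[where f=T, OF unit_blocks_eq]]) (simp_all add: qs(1))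
  then have "trunc_norm N qs (\<lambda>is. norm (T (unit_blocks ns is)))
      \<le> 2 ^ (length qs - 1) * form_norm (sum_list ns) T" for N
    using qs sum_le by (intro trunc_norm_le_array_bound) auto
  then show ?thesis
    using qs by (subst mixed_norm_eq_SUP_trunc_norm) (auto intro!: SUP_least ennreal_leI)
qed

section \<open>Walsh--Hadamard matrices and forms of small norm\<close>

text \<open>The Walsh--Hadamard sign matrix of size \<open>2 ^ r\<close>, by recursion on the binary digits.\<close>

fun hadamard :: "nat \<Rightarrow> nat \<Rightarrow> nat \<Rightarrow> real" where
  "hadamard 0 i j = 1"
| "hadamard (Suc r) i j = hadamard r (i div 2) (j div 2) * (if odd i \<and> odd j then -1 else 1)"

lemma abs_hadamard [simp]: "\<bar>hadamard r i j\<bar> = 1"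
  by (induction r i j rule: hadamard.induct) (auto simp: abs_mult)

lemma sum_even_odd: "(\<Sum>i<2 * n. f i) = (\<Sum>i<n. f (2 * i) + f (2 * i + 1))"
  for n :: nat and f :: "nat \<Rightarrow> 'b::comm_monoid_add"
  by (induction n) (auto simp: add_ac)

lemma sum_norm_hadamard:
  fixes x :: "nat \<Rightarrow> 'b::real_inner"
  shows "(\<Sum>i<2 ^ r. (norm (\<Sum>j<2 ^ r. hadamard r i j *\<^sub>R x j))\<^sup>2) = 2 ^ r * (\<Sum>j<2 ^ r. (norm (x j))\<^sup>2)"
proof (induction r arbitrary: x)
  case (Suc r)
  define u where "u i = (\<Sum>j<2 ^ r. hadamard r i j *\<^sub>R x (2 * j))" for i
  define w where "w i = (\<Sum>j<2 ^ r. hadamard r i j *\<^sub>R x (2 * j + 1))" for i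
  define F where "F i = (\<Sum>j<2 ^ Suc r. hadamard (Suc r) i j *\<^sub>R x j)" for i
  have even: "F (2 * i) = u i + w i" for i
    by (simp add: F_def sum_even_odd u_def w_def sum.distrib)
  have odd: "F (2 * i + 1) = u i - w i" for i
    by (simp add: F_def sum_even_odd u_def w_def sum_subtractf)
  have "(\<Sum>i<2 ^ Suc r. (norm (F i))\<^sup>2) = (\<Sum>i<2 ^ r. (norm (u i + w i))\<^sup>2 + (norm (u i - w i))\<^sup>2)"
    by (simp only: power_Suc[of "2::nat"] sum_even_odd even odd)
  also have "\<dots> = 2 * ((\<Sum>i<2 ^ r. (norm (u i))\<^sup>2) + (\<Sum>i<2 ^ r. (norm (w i))\<^sup>2))"
    by (simp add: power2_norm_eq_inner inner_add_left inner_add_right inner_diff_left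
        inner_diff_right sum_distrib_left flip: sum.distrib)
  also have "\<dots> = 2 ^ Suc r * (\<Sum>j<2 ^ r. (norm (x (2 * j)))\<^sup>2 + (norm (x (2 * j + 1)))\<^sup>2)"
    unfolding u_def w_def Suc.IH by (simp add: sum.distrib algebra_simps)
  also have "\<dots> = 2 ^ Suc r * (\<Sum>j<2 ^ Suc r. (norm (x j))\<^sup>2)"
    by (simp add: sum_even_odd)
  finally show ?case by (simp only: F_def)
qed simp

lemma L2_set_hadamard:
  fixes x :: "nat \<Rightarrow> 'b::real_inner"
  shows "L2_set (\<lambda>i. norm (\<Sum>j<2 ^ r. hadamard r i j *\<^sub>R x j)) {..<2 ^ r}
    = sqrt (2 ^ r) * L2_set (\<lambda>j. norm (x j)) {..<2 ^ r}"
  by (simp add: L2_set_def sum_norm_hadamard real_sqrt_mult)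

text \<open>
  The coefficients of the extremal form: an index at a position marked \<open>True\<close> is linked by an entry
  of the matrix to the preceding marked index, which is \<open>i\<close> at the start; an index at any other
  position has to vanish.
\<close>

fun chain_array :: "nat \<Rightarrow> bool list \<Rightarrow> nat \<Rightarrow> nat list \<Rightarrow> 'a::real_normed_field" where
  "chain_array r (b # bs) i (j # js) =
    (if b then of_real (hadamard r i j) * chain_array r bs j js
     else if j = 0 then chain_array r bs i js else 0)"
| "chain_array r bs i js = 1"

lemma norm_chain_array:
  assumes "length js = length bs"
  shows "norm (chain_array r bs i js) = (if list_all2 (\<lambda>b j. b \<or> j = 0) bs js then 1 else 0)"
  using assms by (induction r bs i js rule: chain_array.induct) (auto simp: norm_mult)

lemma eval_array_mult: "eval_array N xs (\<lambda>is. c * a is) = c * eval_array N xs a"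
  using eval_array_sum[of N xs "\<lambda>_. c" "\<lambda>_. a" "{()}"] by simp

lemma eval_array_zero: "eval_array N xs (\<lambda>is. 0) = 0"
  using eval_array_mult[of N xs 0] by simp

text \<open>
  As a function of the starting index, the value of the form arises from the constant vector \<open>1\<close>,
  whose norm gives the extra factor: a marked position applies a diagonal contraction and then the
  matrix, any other position multiplies by one coordinate of its argument.
\<close>

lemma L2_set_chain_array_le:
  fixes ys :: "(nat \<Rightarrow> 'a::{real_normed_field, real_inner}) list"
  assumes "length ys = length bs" "\<And>y i. y \<in> set ys \<Longrightarrow> norm (y i) \<le> 1"
  shows "L2_set (\<lambda>i. norm (eval_array (2 ^ r) ys (chain_array r bs i))) {..<2 ^ r}
    \<le> sqrt (2 ^ r) ^ Suc (count_list bs True)"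
  using assms
proof (induction ys bs rule: list_induct2)
  case Nil
  then show ?case by (simp add: L2_set_constant)
next
  case (Cons y ys b bs)
  define E where "E i = eval_array (2 ^ r) ys (chain_array r bs i)" for i
  have IH: "L2_set (\<lambda>i. norm (E i)) {..<2 ^ r} \<le> sqrt (2 ^ r) ^ Suc (count_list bs True)"
    unfolding E_def using Cons.prems by (intro Cons.IH) auto
  have y: "norm (y i * E i) \<le> norm (E i)" "norm (y i * E j) \<le> norm (E j)" for i j
    using Cons.prems[of y] by (auto simp: norm_mult mult_left_le_one_le)
  show ?case
  proof (cases b)
    case True
    have "eval_array (2 ^ r) (y # ys) (chain_array r (b # bs) i)
        = (\<Sum>j<2 ^ r. hadamard r i j *\<^sub>R (y j * E j))" for i
      using True by (simp add: eval_array_mult E_def scaleR_conv_of_real mult.left_commute)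
    then have "L2_set (\<lambda>i. norm (eval_array (2 ^ r) (y # ys) (chain_array r (b # bs) i))) {..<2 ^ r}
        = sqrt (2 ^ r) * L2_set (\<lambda>j. norm (y j * E j)) {..<2 ^ r}"
      by (simp only: L2_set_hadamard)
    also have "\<dots> \<le> sqrt (2 ^ r) * L2_set (\<lambda>j. norm (E j)) {..<2 ^ r}"
      using y by (intro mult_left_mono L2_set_mono) auto
    also have "\<dots> \<le> sqrt (2 ^ r) * sqrt (2 ^ r) ^ Suc (count_list bs True)"
      by (intro mult_left_mono IH) auto
    finally show ?thesis using True by simp
  next
    case False
    have "eval_array (2 ^ r) (y # ys) (chain_array r (b # bs) i)
        = (\<Sum>j<(2::nat) ^ r. if j = 0 then y 0 * E i else 0)" for i
      unfolding eval_array.simps using False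
      by (intro sum.cong refl) (auto simp: E_def eval_array_zero)
    also have "(\<Sum>j<(2::nat) ^ r. if j = 0 then y 0 * E i else 0) = y 0 * E i" for i
      by (subst sum.delta) auto
    finally have "L2_set (\<lambda>i. norm (eval_array (2 ^ r) (y # ys) (chain_array r (b # bs) i))) {..<2 ^ r}
        \<le> L2_set (\<lambda>j. norm (E j)) {..<2 ^ r}"
      using y by (simp add: L2_set_mono)
    then show ?thesis using IH False by simp
  qed
qed

section \<open>Forms with prescribed coefficients\<close>

lemma eval_array_eq_sum:
  "eval_array N xs a = (\<Sum>is | length is = length xs \<and> set is \<subseteq> {..<N}.
    prod_list (map2 (\<lambda>x i. x i) xs is) * a is)"
proof (induction xs arbitrary: a)
  case Nil
  have "{is :: nat list. length is = 0 \<and> set is \<subseteq> {..<N}} = {[]}" by auto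
  then show ?case by simp
next
  case (Cons x xs)
  let ?L = "{is. length is = length xs \<and> set is \<subseteq> {..<N}}"
  have L: "{is. length is = length (x # xs) \<and> set is \<subseteq> {..<N}} = (\<lambda>(i, is). i # is) ` ({..<N} \<times> ?L)"
    by (auto simp: image_iff length_Suc_conv)
  have inj: "inj_on (\<lambda>(i, is). i # is) ({..<N} \<times> ?L)" by (auto simp: inj_on_def)
  have "(\<Sum>is | length is = length (x # xs) \<and> set is \<subseteq> {..<N}.
      prod_list (map2 (\<lambda>x i. x i) (x # xs) is) * a is)
    = (\<Sum>(i, is)\<in>{..<N} \<times> ?L. x i * (prod_list (map2 (\<lambda>x i. x i) xs is) * a (i # is)))"
    unfolding L sum.reindex[OF inj] by (intro sum.cong refl) (auto simp: mult.assoc)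
  also have "\<dots> = (\<Sum>i<N. x i * eval_array N xs (\<lambda>is. a (i # is)))"
    unfolding Cons.IH by (simp add: sum.cartesian_product[symmetric] sum_distrib_left)
  finally show ?case by simp
qed

text \<open>The coordinatewise products of successive blocks of \<open>ns\<^sub>1, ns\<^sub>2, \<dots>\<close> vectors.\<close>

fun block_prods :: "nat list \<Rightarrow> (nat \<Rightarrow> 'a) list \<Rightarrow> (nat \<Rightarrow> 'a::comm_monoid_mult) list" where
  "block_prods [] xs = []"
| "block_prods (n # ns) xs = (\<lambda>i. prod_list (map (\<lambda>x. x i) (take n xs))) # block_prods ns (drop n xs)"

lemma length_block_prods [simp]: "length (block_prods ns xs) = length ns"
  by (induction ns xs rule: block_prods.induct) auto

lemma norm_prod_list_le_1:
  "(\<And>x. x \<in> set xs \<Longrightarrow> norm x \<le> 1) \<Longrightarrow> norm (prod_list xs) \<le> 1"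
  for xs :: "'a::real_normed_field list"
  by (induction xs) (auto simp: norm_mult intro: mult_le_one)

lemma norm_block_prods_le_1:
  fixes xs :: "(nat \<Rightarrow> 'a::real_normed_field) list"
  assumes "\<And>x i. x \<in> set xs \<Longrightarrow> norm (x i) \<le> 1" "y \<in> set (block_prods ns xs)"
  shows "norm (y i) \<le> 1"
  using assms
proof (induction ns xs rule: block_prods.induct)
  case (2 n ns xs)
  then show ?case
    by (auto dest!: in_set_takeD in_set_dropD intro!: norm_prod_list_le_1)
qed simp

lemma prod_list_block_prods:
  assumes "length is = length ns" "length xs = sum_list ns"
  shows "prod_list (map2 (\<lambda>x i. x i) (block_prods ns xs) is)
    = prod_list (map2 (\<lambda>x i. x i) xs (concat (map2 replicate ns is)))"
  using assms
proof (induction "is" ns arbitrary: xs rule: list_induct2)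
  case (Cons i "is" n ns)
  have "map2 (\<lambda>x i. x i) ys (replicate (length ys) i) = map (\<lambda>x. x i) ys" for ys :: "(nat \<Rightarrow> 'a) list"
    by (induction ys) auto
  from this[of "take n xs"] have "map2 (\<lambda>x i. x i) (take n xs) (replicate n i) = map (\<lambda>x. x i) (take n xs)"
    using Cons.prems by simp
  moreover have "zip xs (replicate n i @ js) = zip (take n xs) (replicate n i) @ zip (drop n xs) js" for js
    using zip_append[of "take n xs" "replicate n i" "drop n xs" js] Cons.prems by simp
  ultimately show ?case
    using Cons by simp
qed simp

lemma block_prods_unit:
  assumes "length is = length ns" "\<And>n. n \<in> set ns \<Longrightarrow> 1 \<le> n"
  shows "block_prods ns (map (\<lambda>i j. if j = i then 1 else 0) (concat (map2 replicate ns is)))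
    = map (\<lambda>i j. if j = i then 1 else 0 :: 'a::comm_semiring_1) is"
  using assms
  by (induction "is" ns rule: list_induct2) (auto simp: fun_eq_iff power_0_left)

lemma eval_array_unit:
  "set is \<subseteq> {..<N} \<Longrightarrow> eval_array N (map (\<lambda>i j. if j = i then 1 else 0) is) a = a is"
  by (induction "is" arbitrary: a) (simp_all add: if_distrib[of "\<lambda>x. x * _"] sum.delta cong: if_cong)

lemma continuous_map_coordinate:
  assumes "l < m"
  shows "continuous_map (product_topology (\<lambda>_. top_of_set (c0 :: (nat \<Rightarrow>\<^sub>C 'a::real_normed_field) set)) {..<m})
    euclidean (\<lambda>x. apply_bcontfun (x l) i)"
proof -
  have "1-lipschitz_on c0 (\<lambda>f :: nat \<Rightarrow>\<^sub>C 'a. apply_bcontfun f i)"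
    by (rule lipschitz_onI) (auto simp: dist_bounded)
  then have "continuous_on c0 (\<lambda>f :: nat \<Rightarrow>\<^sub>C 'a. apply_bcontfun f i)"
    by (rule lipschitz_on_continuous_on)
  then have coord: "continuous_map (top_of_set c0) euclidean (\<lambda>f :: nat \<Rightarrow>\<^sub>C 'a. apply_bcontfun f i)"
    by simp
  have proj: "continuous_map (product_topology (\<lambda>_. top_of_set (c0 :: (nat \<Rightarrow>\<^sub>C 'a) set)) {..<m})
      (top_of_set c0) (\<lambda>x. x l)"
    using continuous_map_product_projection[of l "{..<m}" "\<lambda>_. top_of_set c0"] assms by simp
  show ?thesis
    using continuous_map_compose[OF proj coord] by (simp add: o_def)
qed

text \<open>Finite sums of products of one coordinate of each argument are continuous forms.\<close>

lemma form_of_coefficients: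
  fixes c :: "'t \<Rightarrow> nat \<Rightarrow> nat" and m :: nat and a :: "'t \<Rightarrow> 'a::real_normed_field"
  assumes "finite I"
  defines "T \<equiv> \<lambda>x. \<Sum>t\<in>I. (\<Prod>l<m. apply_bcontfun (x l) (c t l)) * a t"
  shows "multilinear_form m T" "continuous_form m T"
proof -
  have upd: "(\<Prod>l'<m. apply_bcontfun ((x(l := y)) l') (d l'))
      = apply_bcontfun y (d l) * (\<Prod>l'\<in>{..<m} - {l}. apply_bcontfun (x l') (d l'))"
    if "l < m" for x :: "nat \<Rightarrow> (nat \<Rightarrow>\<^sub>C 'a)" and y l d
    using that by (subst prod.remove[of _ l]) (auto intro!: prod.cong)
  show "multilinear_form m T"
    unfolding multilinear_form_def T_def
    by (auto simp: upd plus_bcontfun.rep_eq apply_scale_seq algebra_simps sum.distrib sum_distrib_left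
        simp del: fun_upd_apply)
  show "continuous_form m T"
    unfolding continuous_form_def T_def continuous_map_atin
    using continuous_map_coordinate[unfolded continuous_map_atin]
    by (auto intro!: tendsto_sum tendsto_mult tendsto_prod)
qed

text \<open>The form with coefficients \<open>a\<close> whose arguments in each block are multiplied coordinatewise.\<close>

definition block_form ::
  "nat \<Rightarrow> nat list \<Rightarrow> (nat list \<Rightarrow> 'a) \<Rightarrow> (nat \<Rightarrow> (nat \<Rightarrow>\<^sub>C 'a::real_normed_field)) \<Rightarrow> 'a" where
  "block_form N ns a x =
    eval_array N (block_prods ns (map (\<lambda>l. apply_bcontfun (x l)) [0..<sum_list ns])) a"

lemma length_concat_replicate:
  "length is = length ns \<Longrightarrow> length (concat (map2 replicate ns is)) = sum_list ns"
  by (induction "is" ns rule: list_induct2) auto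

lemma block_form_multilinear_continuous:
  "multilinear_form (sum_list ns) (block_form N ns a)" "continuous_form (sum_list ns) (block_form N ns a)"
proof -
  let ?I = "{is. length is = length ns \<and> set is \<subseteq> {..<N}}"
  let ?c = "\<lambda>is. concat (map2 replicate ns is)"
  have fin: "finite ?I"
    using finite_lists_length_eq[of "{..<N}" "length ns"] by (simp add: conj_commute)
  have "block_form N ns a = (\<lambda>x. \<Sum>is\<in>?I. (\<Prod>l<sum_list ns. apply_bcontfun (x l) (?c is ! l)) * a is)"
  proof
    fix x :: "nat \<Rightarrow> (nat \<Rightarrow>\<^sub>C 'a)"
    let ?xs = "map (\<lambda>l. apply_bcontfun (x l)) [0..<sum_list ns]"
    have "prod_list (map2 (\<lambda>x i. x i) (block_prods ns ?xs) is)
        = (\<Prod>l<sum_list ns. apply_bcontfun (x l) (?c is ! l))" if "length is = length ns" for "is"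
    proof -
      have "prod_list (map2 (\<lambda>x i. x i) (block_prods ns ?xs) is) = prod_list (map2 (\<lambda>x i. x i) ?xs (?c is))"
        by (rule prod_list_block_prods[OF that]) simp
      then show ?thesis
        using length_concat_replicate[OF that] by (simp add: prod.list_conv_set_nth atLeast0LessThan)
    qed
    then show "block_form N ns a x
        = (\<Sum>is\<in>?I. (\<Prod>l<sum_list ns. apply_bcontfun (x l) (?c is ! l)) * a is)"
      by (simp add: block_form_def eval_array_eq_sum)
  qed
  then show "multilinear_form (sum_list ns) (block_form N ns a)"
    "continuous_form (sum_list ns) (block_form N ns a)"
    using form_of_coefficients[OF fin, of "sum_list ns" "\<lambda>is l. ?c is ! l" a] by simp_all
qed

lemma block_form_unit_blocks:
  assumes "length is = length ns" "\<And>n. n \<in> set ns \<Longrightarrow> 1 \<le> n" "set is \<subseteq> {..<N}"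
  shows "block_form N ns a (unit_blocks ns is) = a is"
proof -
  have "map (\<lambda>l. apply_bcontfun (unit_blocks ns is l)) [0..<sum_list ns]
      = map (\<lambda>i j. if j = i then 1 else 0 :: 'a) (concat (map2 replicate ns is))"
    using length_concat_replicate[OF assms(1)]
    by (intro nth_equalityI) (auto simp: unit_blocks_eq[OF assms(1)] tuple_of_list_def apply_unit_seq)
  then show ?thesis
    using assms by (simp add: block_form_def block_prods_unit eval_array_unit)
qed

lemma form_norm_chain_le:
  assumes "length bs = length ns"
  shows "form_norm (sum_list ns)
      (block_form (2 ^ r) ns (chain_array r bs 0 :: _ \<Rightarrow> 'a::{real_normed_field, real_inner}))
    \<le> sqrt (2 ^ r) ^ Suc (count_list bs True)"
  unfolding form_norm_def
proof (rule cSUP_least)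
  have "restrict (\<lambda>_. 0) {..<sum_list ns} \<in> PiE {..<sum_list ns} (\<lambda>_. c0 \<inter> cball 0 1 :: (nat \<Rightarrow>\<^sub>C 'a) set)"
    by (auto simp: c0_zero)
  then show "PiE {..<sum_list ns} (\<lambda>_. c0 \<inter> cball 0 1 :: (nat \<Rightarrow>\<^sub>C 'a) set) \<noteq> {}" by blast
next
  fix x :: "nat \<Rightarrow> (nat \<Rightarrow>\<^sub>C 'a)"
  assume x: "x \<in> PiE {..<sum_list ns} (\<lambda>_. c0 \<inter> cball 0 1)"
  define ys where "ys = block_prods ns (map (\<lambda>l. apply_bcontfun (x l)) [0..<sum_list ns])"
  have "norm (apply_bcontfun (x l) i) \<le> 1" if "l < sum_list ns" for l i
    using x that norm_bounded[of "x l" i] by (force simp: PiE_iff)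
  then have coord: "norm (z i) \<le> 1"
    if "z \<in> set (map (\<lambda>l. apply_bcontfun (x l)) [0..<sum_list ns])" for z i
    using that by auto
  have ys: "norm (y i) \<le> 1" if "y \<in> set ys" for y i
    using coord that[unfolded ys_def] by (rule norm_block_prods_le_1)
  have "norm (eval_array (2 ^ r) ys (chain_array r bs 0))
      \<le> L2_set (\<lambda>i. norm (eval_array (2 ^ r) ys (chain_array r bs i))) {..<2 ^ r}"
    by (intro member_le_L2_set[of _ 0]) auto
  also have "\<dots> \<le> sqrt (2 ^ r) ^ Suc (count_list bs True)"
    using ys assms by (intro L2_set_chain_array_le) (auto simp: ys_def)
  finally show "norm (block_form (2 ^ r) ns (chain_array r bs 0) x)
      \<le> sqrt (2 ^ r) ^ Suc (count_list bs True)"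
    by (simp add: block_form_def ys_def)
qed

text \<open>
  The absolute values of the coefficients of the extremal form are the indicator function of the
  index lists that vanish at the unmarked positions.
\<close>

lemma trunc_norm_indicator:
  assumes "length qs = length bs" "\<And>q. q \<in> set qs \<Longrightarrow> 0 < q" "0 < N"
    and "\<And>is. length is = length bs \<Longrightarrow> set is \<subseteq> {..<N} \<Longrightarrow>
      f is = (if list_all2 (\<lambda>b i. b \<or> i = 0) bs is then 1 else 0)"
  shows "trunc_norm N qs f = real N powr (sum_list (map2 (\<lambda>b q. if b then 1 / q else 0) bs qs))"
  using assms
proof (induction qs bs arbitrary: f rule: list_induct2)
  case Nil
  then show ?case by simp
next
  case (Cons q qs b bs)
  let ?s = "sum_list (map2 (\<lambda>b q. if b then 1 / q else 0) bs qs)"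
  have q: "0 < q" using Cons.prems by simp
  have IH: "trunc_norm N qs (\<lambda>is. f (i # is)) = real N powr ?s" if "i < N" "b \<or> i = 0" for i
    using that Cons.prems by (intro Cons.IH) auto
  show ?case
  proof (cases b)
    case True
    then have "(\<Sum>i<N. trunc_norm N qs (\<lambda>is. f (i # is)) powr q) = real N * real N powr (?s * q)"
      using IH by (simp add: powr_powr)
    then show ?thesis
      using True q by (simp add: powr_mult powr_powr powr_add)
  next
    case False
    have 0: "trunc_norm N qs g = 0" if "\<And>is. length is = length bs \<Longrightarrow> set is \<subseteq> {..<N} \<Longrightarrow> g is = 0" for g
      using Cons.hyps that
    proof (induction qs bs arbitrary: g rule: list_induct2)
      case (Cons q qs b bs)
      have "trunc_norm N qs (\<lambda>is. g (i # is)) = 0" if "i < N" for i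
        using that Cons.prems by (intro Cons.IH) auto
      then show ?case by simp
    qed simp
    have "trunc_norm N qs (\<lambda>is. f (i # is)) = (if i = 0 then real N powr ?s else 0)" if "i < N" for i
      using that IH[of i] Cons.prems(3) False by (auto intro!: 0)
    then have "(\<Sum>i<N. trunc_norm N qs (\<lambda>is. f (i # is)) powr q)
        = (\<Sum>i<N. if i = 0 then real N powr (?s * q) else 0)"
      by (intro sum.cong) (auto simp: powr_powr)
    also have "\<dots> = real N powr (?s * q)"
      using Cons.prems(2) by (subst sum.delta) auto
    finally show ?thesis
      using False q by (simp add: powr_powr)
  qed
qed

text \<open>The list \<open>bs\<close> is the indicator function of the set of positions to be tested.\<close>

theorem exponents_necessary:
  fixes ns :: "nat list" and qs :: "real list" and bs :: "bool list" and C :: real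
  assumes C: "0 \<le> C"
    and bound: "\<And>T :: (nat \<Rightarrow> (nat \<Rightarrow>\<^sub>C 'a::{real_normed_field, real_inner})) \<Rightarrow> 'a.
      multilinear_form (sum_list ns) T \<Longrightarrow> continuous_form (sum_list ns) T \<Longrightarrow>
      mixed_norm qs (\<lambda>is. ennreal (norm (T (unit_blocks ns is)))) \<le> ennreal (C * form_norm (sum_list ns) T)"
    and ns: "\<And>n. n \<in> set ns \<Longrightarrow> 1 \<le> n"
    and qs: "length qs = length ns" "qs \<noteq> []" "\<And>q. q \<in> set qs \<Longrightarrow> 0 < q"
    and bs: "length bs = length ns"
  shows "sum_list (map2 (\<lambda>b q. if b then 1 / q else 0) bs qs) \<le> (real (count_list bs True) + 1) / 2"
proof -
  define s where "s = sum_list (map2 (\<lambda>b q. if b then 1 / q else 0) bs qs)"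
  define e where "e = (real (count_list bs True) + 1) / 2"
  have le: "(2 powr (s - e)) ^ r \<le> C" for r
  proof -
    define T :: "(nat \<Rightarrow> (nat \<Rightarrow>\<^sub>C 'a)) \<Rightarrow> 'a" where "T = block_form (2 ^ r) ns (chain_array r bs 0)"
    have T: "multilinear_form (sum_list ns) T" "continuous_form (sum_list ns) T"
      unfolding T_def by (rule block_form_multilinear_continuous)+
    have "trunc_norm (2 ^ r) qs (\<lambda>is. norm (T (unit_blocks ns is))) = real (2 ^ r) powr s"
      unfolding s_def using qs bs ns
      by (intro trunc_norm_indicator) (auto simp: T_def block_form_unit_blocks norm_chain_array)
    then have "ennreal (real (2 ^ r) powr s) \<le> mixed_norm qs (\<lambda>is. ennreal (norm (T (unit_blocks ns is))))"
      using qs by (subst mixed_norm_eq_SUP_trunc_norm) (auto intro!: SUP_upper2[of "2 ^ r"])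
    also have "\<dots> \<le> ennreal (C * form_norm (sum_list ns) T)"
      by (rule bound[OF T])
    also have "\<dots> \<le> ennreal (C * sqrt (2 ^ r) ^ Suc (count_list bs True))"
      unfolding T_def using C bs by (intro ennreal_leI mult_left_mono form_norm_chain_le) auto
    finally have "real (2 ^ r) powr s \<le> C * sqrt (2 ^ r) ^ Suc (count_list bs True)"
      using C by (subst (asm) ennreal_le_iff) auto
    also have "sqrt (2 ^ r) ^ Suc (count_list bs True) = real (2 ^ r) powr e"
    proof -
      have "sqrt (2 ^ r) ^ Suc (count_list bs True) = sqrt (2 ^ r) powr real (Suc (count_list bs True))"
        by (subst powr_realpow) auto
      also have "\<dots> = real (2 ^ r) powr e"
        unfolding e_def by (subst powr_half_sqrt[symmetric]) (simp_all add: powr_powr add.commute)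
      finally show ?thesis .
    qed
    finally have "real (2 ^ r) powr (s - e) \<le> C"
      by (simp add: powr_diff field_simps)
    then show ?thesis
      by (simp add: powr_realpow[symmetric] powr_powr mult.commute)
  qed
  have "s \<le> e"
  proof (rule ccontr)
    assume "\<not> s \<le> e"
    then have "1 < 2 powr (s - e)" by simp
    then obtain r where "C < (2 powr (s - e)) ^ r" using real_arch_pow by blast
    with le[of r] show False by simp
  qed
  then show ?thesis by (simp add: s_def e_def)
qed

section \<open>The characterization\<close>

text \<open>The equivalence for both scalar fields at once.\<close>

lemma summability_by_blocks_iff:
  fixes k m :: nat and n :: "nat \<Rightarrow> nat" and q :: "nat \<Rightarrow> real"
  assumes k: "1 \<le> k"
    and n: "\<And>j. j \<in> {1..k} \<Longrightarrow> 1 \<le> n j"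
    and m: "(\<Sum>j=1..k. n j) = m"
    and q: "\<And>j. j \<in> {1..k} \<Longrightarrow> 0 < q j"
  shows
    "(\<exists>C::real. C \<ge> 1 \<and>
        (\<forall>T :: (nat \<Rightarrow> (nat \<Rightarrow>\<^sub>C 'a::{real_normed_field, real_inner})) \<Rightarrow> 'a.
          multilinear_form m T \<and> continuous_form m T \<longrightarrow>
          mixed_norm (map q [1..<k+1])
              (\<lambda>is. ennreal (norm (T (unit_blocks (map n [1..<k+1]) is))))
            \<le> ennreal (C * form_norm m T)))
      \<longleftrightarrow> (\<forall>A\<subseteq>{1..k}. (\<Sum>j\<in>A. 1 / q j) \<le> (real (card A) + 1) / 2)"
    (is "?bounded \<longleftrightarrow> ?exponents")
proof -
  define ns where "ns = map n [1..<k+1]"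
  define qs where "qs = map q [1..<k+1]"
  have sum_ns: "sum_list ns = m"
    by (simp add: ns_def m[symmetric] interv_sum_list_conv_sum_set_nat
        atLeastLessThanSuc_atLeastAtMost del: upt_Suc)
  have ns: "1 \<le> n'" if "n' \<in> set ns" for n' using that n by (auto simp: ns_def)
  have qs: "length qs = length ns" "qs \<noteq> []" "\<And>q'. q' \<in> set qs \<Longrightarrow> 0 < q'"
    using k q by (auto simp: qs_def ns_def)
  have ?exponents if ?bounded
  proof -
    from that obtain C where C: "C \<ge> 1"
      "\<And>T :: (nat \<Rightarrow> (nat \<Rightarrow>\<^sub>C 'a)) \<Rightarrow> 'a. multilinear_form (sum_list ns) T \<Longrightarrow> continuous_form (sum_list ns) T \<Longrightarrow>
          mixed_norm qs (\<lambda>is. ennreal (norm (T (unit_blocks ns is)))) \<le> ennreal (C * form_norm (sum_list ns) T)"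
      unfolding sum_ns unfolding ns_def qs_def by blast
    show ?thesis
    proof (intro allI impI)
      fix A assume A: "A \<subseteq> {1..k}"
      define bs where "bs = map (\<lambda>j. j \<in> A) [1..<k+1]"
      have "sum_list (map2 (\<lambda>b q. if b then 1 / q else 0) bs qs) = (\<Sum>j\<in>{1..k}. if j \<in> A then 1 / q j else 0)"
        by (simp add: bs_def qs_def zip_map1 zip_map2 zip_same_conv_map o_def sum_list_distinct_conv_sum_set
            atLeastLessThanSuc_atLeastAtMost del: upt_Suc sum.op_ivl_Suc)
      also have "\<dots> = (\<Sum>j\<in>A. 1 / q j)"
        using A by (simp add: sum.inter_restrict[symmetric] Int_absorb1)
      finally have s: "sum_list (map2 (\<lambda>b q. if b then 1 / q else 0) bs qs) = (\<Sum>j\<in>A. 1 / q j)" .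
      have "count_list bs True = length (filter (\<lambda>j. j \<in> A) [1..<k+1])"
        by (simp add: bs_def count_list_eq_length_filter filter_map o_def del: upt_Suc)
      also have "\<dots> = card ({1..k} \<inter> A)"
        by (subst distinct_card[symmetric]) (auto simp: intro!: arg_cong[where f=card])
      finally have c: "count_list bs True = card A"
        using A by (simp add: Int_absorb1)
      have "length bs = length ns" "0 \<le> C"
        using C(1) by (simp_all add: bs_def ns_def)
      from exponents_necessary[OF this(2) C(2) ns qs this(1)]
      show "(\<Sum>j\<in>A. 1 / q j) \<le> (real (card A) + 1) / 2"
        unfolding s c .
    qed
  qed
  moreover have ?bounded if *: ?exponents
  proof -
    \<comment> \<open>only the indices in this set contribute to the sum of positive parts\<close>
    define A where "A = {j \<in> {1..k}. 1 / q j > 1 / 2}"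
    have "(\<Sum>j<length qs. max 0 (2 / qs ! j - 1)) = (\<Sum>j\<in>{1..k}. max 0 (2 / q j - 1))"
      by (rule sum.reindex_bij_witness[of _ "\<lambda>j. j - 1" Suc]) (auto simp: qs_def simp del: upt_Suc)
    also have "\<dots> = (\<Sum>j\<in>A. 2 / q j - 1)"
      by (rule sum.mono_neutral_cong_right) (auto simp: A_def)
    also have "\<dots> = 2 * (\<Sum>j\<in>A. 1 / q j) - card A"
      by (simp add: sum_subtractf sum_distrib_left)
    also have "\<dots> \<le> 1"
    proof -
      have "A \<subseteq> {1..k}" by (auto simp: A_def)
      moreover have "2 * S - c \<le> 1" if "S \<le> (c + 1) / 2" for S c :: real
        using that by simp
      ultimately show ?thesis using * by blast
    qed
    finally have sum_le: "(\<Sum>j<length qs. max 0 (2 / qs ! j - 1)) \<le> 1" .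
    have "\<forall>T :: (nat \<Rightarrow> (nat \<Rightarrow>\<^sub>C 'a)) \<Rightarrow> 'a. multilinear_form m T \<and> continuous_form m T \<longrightarrow>
          mixed_norm qs (\<lambda>is. ennreal (norm (T (unit_blocks ns is))))
            \<le> ennreal (2 ^ (length qs - 1) * form_norm m T)"
      using mixed_norm_le_form_norm[OF _ _ ns qs sum_le] unfolding sum_ns by blast
    then show ?thesis
      unfolding ns_def qs_def
      by (intro exI[of _ "2 ^ (length (map q [1..<k+1]) - 1)"] conjI) simp_all
  qed
  ultimately show ?thesis by blast
qed

theorem theorem1p2:
  fixes k m :: nat and n :: "nat \<Rightarrow> nat" and q :: "nat \<Rightarrow> real"
  assumes "1 \<le> k" and "k \<le> m"
    and "\<And>j. j \<in> {1..k} \<Longrightarrow> 1 \<le> n j"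
    and "(\<Sum>j=1..k. n j) = m"
    and "\<And>j. j \<in> {1..k} \<Longrightarrow> 0 < q j"
  shows
    "((\<exists>C::real. C \<ge> 1 \<and>
        (\<forall>T :: (nat \<Rightarrow> (nat \<Rightarrow>\<^sub>C real)) \<Rightarrow> real. multilinear_form m T \<and> continuous_form m T \<longrightarrow>
          mixed_norm (map q [1..<k+1])
              (\<lambda>is. ennreal (norm (T (unit_blocks (map n [1..<k+1]) is))))
            \<le> ennreal (C * form_norm m T)))
      \<longleftrightarrow> (\<forall>A\<subseteq>{1..k}. (\<Sum>j\<in>A. 1 / q j) \<le> (real (card A) + 1) / 2))
     \<and>
     ((\<exists>C::real. C \<ge> 1 \<and>
        (\<forall>T :: (nat \<Rightarrow> (nat \<Rightarrow>\<^sub>C complex)) \<Rightarrow> complex. multilinear_form m T \<and> continuous_form m T \<longrightarrow>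
          mixed_norm (map q [1..<k+1])
              (\<lambda>is. ennreal (norm (T (unit_blocks (map n [1..<k+1]) is))))
            \<le> ennreal (C * form_norm m T)))
      \<longleftrightarrow> (\<forall>A\<subseteq>{1..k}. (\<Sum>j\<in>A. 1 / q j) \<le> (real (card A) + 1) / 2))"
  by (intro conjI summability_by_blocks_iff assms)

end
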